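(* Let $t$ be a quasi-homogeneous holomorphic curve of rank $n$ with atoms $t_i$, and let $T=(S_{i,j})$ be the atomic decomposition of the corresponding quasi-homogeneous operator $T$, with diagonal entries $T_i=S_{i,i}$. (1) If $\Lambda(t)\ge2$, then $T$ is strongly reducible; indeed $T$ is similar to the direct sum of its atoms, namely $\bigoplus_{i=0}^{n-1}T_i$. (2) If $\Lambda(t)<2$, then $T$ is strongly irreducible.
   Context: $\mathbb D$ is the open unit disc. For $\lambda>0$, $\mathbb A^{(\lambda)}(\mathbb D)$ is the Hilbert space of holomorphic functions on $\mathbb D$ with reproducing kernel $(1-z\bar w)^{-\lambda}$. $B_n(\mathbb D)$ is the Cowen–Douglas class: bounded operators $T$ on a separable Hilbert space such that for each $w\in\mathbb D$, $T-w$ is surjective and $\dim\ker(T-w)=n$, and the subspaces $\ker(T-w)$ span a dense subspace. A quasi-homogeneous holomorphic curve $t$ of rank $n\ge2$ is given by: $\lambda_0>0$, a valency $\Lambda(t)>0$, $\lambda_i=\lambda_0+i\Lambda(t)$, and complex constants $\mu_{i,j}$ ($0\le i\le j\le n-1$) with $\mu_{i,i}=1$ and $\mu_{i,i+1}\ne0$. Put $\mathcal H_i=\mathbb A^{(\lambda_i)}(\mathbb D)$, $\mathcal H=\mathcal H_0\oplus\cdots\oplus\mathcal H_{n-1}$, atoms $t_i(w)(z)=(1-zw)^{-\lambda_i}\in\mathcal H_i$, frame $\gamma_j(w)=\sum_{i=0}^j\mu_{i,j}t_i^{(j-i)}(w)$ (derivatives in $w$), and $t(w)=\mathrm{span}\{\gamma_0(w),\dots,\gamma_{n-1}(w)\}$.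 Standing assumption: the linear transformation $T$ with $T\gamma_j(w)=w\gamma_j(w)$ extends to a bounded operator on $\mathcal H$ belonging to $B_n(\mathbb D)$; this $T$ is the quasi-homogeneous operator corresponding to $t$. With respect to $\mathcal H=\bigoplus\mathcal H_i$ it is upper triangular, $T=(S_{i,j})$, with $S_{i,i}=T_i$ the adjoint of multiplication by the coordinate on $\mathbb A^{(\lambda_i)}(\mathbb D)$. A bounded operator $T$ is strongly irreducible if there is no non-trivial idempotent (i.e. other than $0$ and $I$) in its commutant; equivalently, there is no bounded invertible $L$ for which $LTL^{-1}$ is reducible. Otherwise it is strongly reducible. *)

theory Defs
  imports "HOL-Analysis.Analysis" "HOL-Library.Function_Algebras"
begin

section \<open>Complex Hilbert spaces on explicit carriers\<close>

text \<open>
  The spaces \<open>A^(\<lambda>)\<close> depend on a real parameter, hence cannot be types. A Hilbert space is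
  therefore a set of vectors together with an inner product that is only meaningful on that set;
  likewise, operators are functions whose values off the carrier are irrelevant.
\<close>

class complex_vector = ab_group_add +
  fixes scaleC :: "complex \<Rightarrow> 'a \<Rightarrow> 'a" (infixr \<open>*\<^sub>C\<close> 75)
  assumes scaleC_add_right: "a *\<^sub>C (x + y) = a *\<^sub>C x + a *\<^sub>C y"
    and scaleC_add_left: "(a + b) *\<^sub>C x = a *\<^sub>C x + b *\<^sub>C x"
    and scaleC_scaleC: "a *\<^sub>C b *\<^sub>C x = (a * b) *\<^sub>C x"
    and scaleC_one: "1 *\<^sub>C x = x"

lemma vector_space_scaleC:
  "vector_space (scaleC :: complex \<Rightarrow> 'a \<Rightarrow> 'a::complex_vector)"
  by standard (simp_all add: scaleC_add_right scaleC_add_left scaleC_scaleC scaleC_one)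

instantiation complex :: complex_vector
begin

definition scaleC_complex :: "complex \<Rightarrow> complex \<Rightarrow> complex"
  where "scaleC_complex a x = a * x"

instance
  by standard (simp_all add: scaleC_complex_def algebra_simps)

end

instantiation "fun" :: (type, complex_vector) complex_vector
begin

definition scaleC_fun :: "complex \<Rightarrow> ('a \<Rightarrow> 'b) \<Rightarrow> 'a \<Rightarrow> 'b"
  where "scaleC_fun a f = (\<lambda>x. a *\<^sub>C f x)"

instance
  by standard
    (simp_all add: scaleC_fun_def fun_eq_iff scaleC_add_right scaleC_add_left scaleC_scaleC scaleC_one)

end

record 'a hspace =
  carrier :: "'a set"
  ip :: "'a \<Rightarrow> 'a \<Rightarrow> complex"

definition hnorm :: "'a hspace \<Rightarrow> 'a \<Rightarrow> real"
  where "hnorm H x = sqrt (Re (ip H x x))"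

definition hilbert_space :: "'a::complex_vector hspace \<Rightarrow> bool"
  where "hilbert_space H \<longleftrightarrow>
    module.subspace scaleC (carrier H) \<and>
    (\<forall>x\<in>carrier H. \<forall>y\<in>carrier H. \<forall>z\<in>carrier H. ip H (x + y) z = ip H x z + ip H y z) \<and>
    (\<forall>a. \<forall>x\<in>carrier H. \<forall>y\<in>carrier H. ip H (a *\<^sub>C x) y = a * ip H x y) \<and>
    (\<forall>x\<in>carrier H. \<forall>y\<in>carrier H. ip H y x = cnj (ip H x y)) \<and>
    (\<forall>x\<in>carrier H. x \<noteq> 0 \<longrightarrow> Re (ip H x x) > 0) \<and>
    (\<forall>X :: nat \<Rightarrow> 'a.
      (\<forall>k. X k \<in> carrier H) \<and> (\<forall>e>0. \<exists>M. \<forall>k\<ge>M. \<forall>l\<ge>M. hnorm H (X k - X l) < e) \<longrightarrow>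
      (\<exists>x\<in>carrier H. (\<lambda>k. hnorm H (X k - x)) \<longlonglongrightarrow> 0))"

definition dense_in :: "'a::complex_vector hspace \<Rightarrow> 'a set \<Rightarrow> bool"
  where "dense_in H A \<longleftrightarrow>
    A \<subseteq> carrier H \<and> (\<forall>x\<in>carrier H. \<forall>e>0. \<exists>a\<in>A. hnorm H (x - a) < e)"

definition separable :: "'a::complex_vector hspace \<Rightarrow> bool"
  where "separable H \<longleftrightarrow> (\<exists>A. countable A \<and> dense_in H A)"

definition bounded_op :: "'a::complex_vector hspace \<Rightarrow> ('a \<Rightarrow> 'a) \<Rightarrow> bool"
  where "bounded_op H A \<longleftrightarrow>
    (\<forall>x\<in>carrier H. A x \<in> carrier H) \<and>
    (\<forall>x\<in>carrier H. \<forall>y\<in>carrier H. A (x + y) = A x + A y) \<and>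
    (\<forall>a. \<forall>x\<in>carrier H. A (a *\<^sub>C x) = a *\<^sub>C A x) \<and>
    (\<exists>C. \<forall>x\<in>carrier H. hnorm H (A x) \<le> C * hnorm H x)"

text \<open>The Hilbert space adjoint; the vector described is unique when \<open>A\<close> is bounded.\<close>

definition adjoint_op :: "'a hspace \<Rightarrow> ('a \<Rightarrow> 'a) \<Rightarrow> 'a \<Rightarrow> 'a"
  where "adjoint_op H A y =
    (THE u. u \<in> carrier H \<and> (\<forall>x\<in>carrier H. ip H (A x) y = ip H x u))"

definition similar_ops :: "'a::complex_vector hspace \<Rightarrow> ('a \<Rightarrow> 'a) \<Rightarrow> ('a \<Rightarrow> 'a) \<Rightarrow> bool"
  where "similar_ops H A B \<longleftrightarrow>
    (\<exists>L M. bounded_op H L \<and> bounded_op H M \<and>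
      (\<forall>x\<in>carrier H. L (M x) = x \<and> M (L x) = x) \<and>
      (\<forall>x\<in>carrier H. L (A (M x)) = B x))"

definition strongly_irreducible :: "'a::complex_vector hspace \<Rightarrow> ('a \<Rightarrow> 'a) \<Rightarrow> bool"
  where "strongly_irreducible H A \<longleftrightarrow>
    \<not> (\<exists>P. bounded_op H P \<and>
        (\<forall>x\<in>carrier H. P (A x) = A (P x)) \<and>
        (\<forall>x\<in>carrier H. P (P x) = P x) \<and>
        (\<exists>x\<in>carrier H. P x \<noteq> 0) \<and>
        (\<exists>x\<in>carrier H. P x \<noteq> x))"

abbreviation strongly_reducible :: "'a::complex_vector hspace \<Rightarrow> ('a \<Rightarrow> 'a) \<Rightarrow> bool"
  where "strongly_reducible H A \<equiv> \<not> strongly_irreducible H A"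

section \<open>The Cowen--Douglas class\<close>

definition eigenspace :: "'a::complex_vector hspace \<Rightarrow> ('a \<Rightarrow> 'a) \<Rightarrow> complex \<Rightarrow> 'a set"
  where "eigenspace H A w = {x \<in> carrier H. A x - w *\<^sub>C x = 0}"

text \<open>
  The library's dimension is \<open>0\<close> on infinite-dimensional spaces, so for \<open>n \<ge> 1\<close> the condition
  below does say that the eigenspaces have finite dimension \<open>n\<close>.
\<close>

definition cowen_douglas ::
    "nat \<Rightarrow> complex set \<Rightarrow> 'a::complex_vector hspace \<Rightarrow> ('a \<Rightarrow> 'a) \<Rightarrow> bool"
  where "cowen_douglas n \<Omega> H A \<longleftrightarrow>
    n \<ge> 1 \<and> hilbert_space H \<and> separable H \<and> bounded_op H A \<and>
    (\<forall>w\<in>\<Omega>. (\<lambda>x. A x - w *\<^sub>C x) ` carrier H = carrier H) \<and>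
    (\<forall>w\<in>\<Omega>. vector_space.dim scaleC (eigenspace H A w) = n) \<and>
    dense_in H (module.span scaleC (\<Union>w\<in>\<Omega>. eigenspace H A w))"

section \<open>The spaces with kernel \<open>(1 - z w*)^(-\<lambda>)\<close>\<close>

abbreviation unit_disc :: "complex set" (\<open>\<D>\<close>)
  where "\<D> \<equiv> ball 0 1"

text \<open>
  A function on \<open>\<Omega>\<close> is represented by its extension by \<open>0\<close> to the whole plane, so that equality of
  functions is equality on \<open>\<Omega>\<close>.
\<close>

definition on_domain :: "complex set \<Rightarrow> (complex \<Rightarrow> complex) \<Rightarrow> complex \<Rightarrow> complex"
  where "on_domain \<Omega> f = (\<lambda>z. if z \<in> \<Omega> then f z else 0)"

definition has_reproducing_kernel ::
    "complex set \<Rightarrow> (complex \<Rightarrow> complex) hspace \<Rightarrow> (complex \<Rightarrow> complex \<Rightarrow> complex) \<Rightarrow> bool"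
  where "has_reproducing_kernel \<Omega> H K \<longleftrightarrow>
    (\<forall>f\<in>carrier H. on_domain \<Omega> f = f) \<and>
    (\<forall>w\<in>\<Omega>. on_domain \<Omega> (\<lambda>z. K z w) \<in> carrier H \<and>
      (\<forall>f\<in>carrier H. ip H f (on_domain \<Omega> (\<lambda>z. K z w)) = f w))"

text \<open>
  \<open>is_A_space \<lambda> H\<close> says that \<open>H\<close> is the space \<open>A^(\<lambda>)\<close> on the disc; this determines the carrier and,
  on it, the inner product. The principal branch is the right one, as \<open>1 - z w\<close> has positive real
  part for \<open>z\<close>, \<open>w\<close> in the disc.
\<close>

definition is_A_space :: "real \<Rightarrow> (complex \<Rightarrow> complex) hspace \<Rightarrow> bool"
  where "is_A_space l H \<longleftrightarrow>
    hilbert_space H \<and>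
    (\<forall>f\<in>carrier H. f holomorphic_on \<D>) \<and>
    has_reproducing_kernel \<D> H (\<lambda>z w. (1 - z * cnj w) powr (- of_real l))"

definition mult_coordinate :: "(complex \<Rightarrow> complex) \<Rightarrow> complex \<Rightarrow> complex"
  where "mult_coordinate f = (\<lambda>z. z * f z)"

section \<open>Finite direct sums\<close>

text \<open>Elements of the sum of \<open>H 0, \<dots>, H (n - 1)\<close> are sequences that vanish from index \<open>n\<close> on.\<close>

definition direct_sum :: "nat \<Rightarrow> (nat \<Rightarrow> 'a::complex_vector hspace) \<Rightarrow> (nat \<Rightarrow> 'a) hspace"
  where "direct_sum n H =
    \<lparr>carrier = {x. (\<forall>i<n. x i \<in> carrier (H i)) \<and> (\<forall>i\<ge>n. x i = 0)},
     ip = (\<lambda>x y. \<Sum>i<n. ip (H i) (x i) (y i))\<rparr>"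

definition direct_sum_op ::
    "nat \<Rightarrow> (nat \<Rightarrow> 'a::complex_vector \<Rightarrow> 'a) \<Rightarrow> (nat \<Rightarrow> 'a) \<Rightarrow> nat \<Rightarrow> 'a"
  where "direct_sum_op n A x = (\<lambda>i. if i < n then A i (x i) else 0)"

text \<open>The entry from the \<open>j\<close>-th to the \<open>i\<close>-th summand in the block matrix of \<open>A\<close>.\<close>

definition block :: "((nat \<Rightarrow> 'a::complex_vector) \<Rightarrow> nat \<Rightarrow> 'a) \<Rightarrow> nat \<Rightarrow> nat \<Rightarrow> 'a \<Rightarrow> 'a"
  where "block A i j x = A (\<lambda>k. if k = j then x else 0) i"

section \<open>Quasi-homogeneous curves and operators\<close>

definition quasi_homogeneous_curve ::
    "nat \<Rightarrow> real \<Rightarrow> real \<Rightarrow> (nat \<Rightarrow> nat \<Rightarrow> complex) \<Rightarrow> bool"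
  where "quasi_homogeneous_curve n lam0 \<Lambda> \<mu> \<longleftrightarrow>
    n \<ge> 2 \<and> lam0 > 0 \<and> \<Lambda> > 0 \<and>
    (\<forall>i<n. \<mu> i i = 1) \<and> (\<forall>i. i + 1 < n \<longrightarrow> \<mu> i (i + 1) \<noteq> 0)"

definition qh_weight :: "real \<Rightarrow> real \<Rightarrow> nat \<Rightarrow> real"
  where "qh_weight lam0 \<Lambda> i = lam0 + real i * \<Lambda>"

text \<open>
  \<open>atom_deriv l k w\<close> is the \<open>k\<close>-th derivative, with respect to the curve parameter \<open>w\<close>, of the atom
  \<open>w \<mapsto> (z \<mapsto> (1 - z w)^(-l))\<close>. It is taken pointwise in \<open>z\<close>; since point evaluations are bounded on
  \<open>A^(l)\<close>, it agrees with the derivative of the Hilbert space valued map.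
\<close>

definition atom_deriv :: "real \<Rightarrow> nat \<Rightarrow> complex \<Rightarrow> complex \<Rightarrow> complex"
  where "atom_deriv l k w =
    on_domain \<D> (\<lambda>z. (deriv ^^ k) (\<lambda>v. (1 - z * v) powr (- of_real l)) w)"

definition qh_frame ::
    "real \<Rightarrow> real \<Rightarrow> (nat \<Rightarrow> nat \<Rightarrow> complex) \<Rightarrow> nat \<Rightarrow> complex \<Rightarrow> nat \<Rightarrow> complex \<Rightarrow> complex"
  where "qh_frame lam0 \<Lambda> \<mu> j w =
    (\<lambda>i. if i \<le> j then \<mu> i j *\<^sub>C atom_deriv (qh_weight lam0 \<Lambda> i) (j - i) w else 0)"

definition quasi_homogeneous_op ::
    "nat \<Rightarrow> real \<Rightarrow> real \<Rightarrow> (nat \<Rightarrow> nat \<Rightarrow> complex) \<Rightarrow> (nat \<Rightarrow> (complex \<Rightarrow> complex) hspace) \<Rightarrow>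
      ((nat \<Rightarrow> complex \<Rightarrow> complex) \<Rightarrow> nat \<Rightarrow> complex \<Rightarrow> complex) \<Rightarrow> bool"
  where "quasi_homogeneous_op n lam0 \<Lambda> \<mu> H T \<longleftrightarrow>
    bounded_op (direct_sum n H) T \<and>
    (\<forall>w\<in>\<D>. \<forall>j<n. T (qh_frame lam0 \<Lambda> \<mu> j w) = w *\<^sub>C qh_frame lam0 \<Lambda> \<mu> j w) \<and>
    cowen_douglas n \<D> (direct_sum n H) T"

end

theory Submission
  imports Defs "HOL-Complex_Analysis.Cauchy_Integral_Formula"
begin

text \<open>
  The atom \<open>t\<^sub>i(w)\<close> is the kernel function of the \<open>i\<close>-th space at the conjugate of \<open>w\<close>, and the problem
  becomes one about infinite matrices in suitable coordinates. Let \<open>a\<^sub>k = (\<lambda>)\<^sub>k / k!\<close> be the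
  coefficients of \<open>(1 - x)\<close> to the power \<open>-\<lambda>\<close>. The moments \<open>d\<^sub>k = \<langle>f, z\<^sup>k\<rangle>\<close> of \<open>f\<close> in \<open>A^(\<lambda>)\<close> satisfy
  \<open>f(z) = \<Sum> a\<^sub>k d\<^sub>k z\<^sup>k\<close> and \<open>\<parallel>f\<parallel>\<^sup>2 = \<Sum> a\<^sub>k \<bar>d\<^sub>k\<bar>\<^sup>2\<close>, and every sequence for which the latter sum is finite
  occurs. Independently of \<open>\<lambda>\<close>, the atom has the moments \<open>w\<^sup>k\<close>, its derivatives have the derivatives of
  \<open>w\<^sup>k\<close> as moments, and the adjoint of multiplication by the coordinate is the shift of moments
  (\<open>adjoint_mult_coordinate\<close>). A bounded map is determined by its values at the atoms, because the
  moments of these values are power series in \<open>w\<close> with the matrix entries as coefficients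
  (\<open>entry_determined_by_atoms\<close>). Reading \<open>T \<gamma>\<^sub>j(w) = w \<gamma>\<^sub>j(w)\<close> component by component therefore shows
  that \<open>T\<close> is upper triangular, that its diagonal blocks are the shifts, and that the block
  \<open>(i, i + 1)\<close> maps \<open>t\<^sub>i\<^sub>+\<^sub>1(w)\<close> to \<open>-\<mu> t\<^sub>i(w)\<close> with \<open>\<mu> = \<mu> i (i + 1)\<close>.

  If \<open>\<Lambda> \<ge> 2\<close>, the map \<open>t\<^sub>j(w) \<mapsto> \<gamma>\<^sub>j(w)\<close> is bounded: its blocks are multiples of the maps from \<open>t\<^sub>j\<close> to
  the derivative of order \<open>j - i\<close> of \<open>t\<^sub>i\<close>, and a derivative of order \<open>m\<close> is bounded as soon as the
  weight drops by \<open>2 m\<close> (\<open>kcoeff_derivative_bound\<close>). It is unipotent, hence invertible, and it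
  intertwines \<open>T\<close> with the direct sum of its diagonal blocks (\<open>similar_to_atoms\<close>).

  If \<open>\<Lambda> < 2\<close>, let \<open>P\<close> be an idempotent commuting with \<open>T\<close>. Its blocks below the diagonal come down
  to intertwiners of shifts into a space of larger weight. The matrix of an intertwiner is constant
  along diagonals, and since the \<open>a\<^sub>k\<close> of the larger weight grow faster, only zero is bounded
  (\<open>intertwiner_zero\<close>). So \<open>P\<close> is upper triangular, and each of its diagonal blocks is an idempotent
  commuting with a shift, in other words an idempotent formal power series, hence \<open>0\<close> or \<open>1\<close>
  (\<open>commuting_idempotent\<close>). If two adjacent diagonal blocks were different, the block \<open>X\<close> of \<open>P\<close>
  between them would satisfy \<open>T\<^sub>i X - X T\<^sub>i\<^sub>+\<^sub>1 = c R\<close> with \<open>c \<noteq> 0\<close> and \<open>R\<close> taking \<open>t\<^sub>i\<^sub>+\<^sub>1(w)\<close> to \<open>t\<^sub>i(w)\<close>.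
  Up to an intertwiner, \<open>X\<close> would be \<open>c\<close> times the map from \<open>t\<^sub>i\<^sub>+\<^sub>1\<close> to the first derivative of \<open>t\<^sub>i\<close>,
  which needs a weight difference of at least \<open>2\<close> (\<open>inner_derivation_bound\<close>). So the diagonal of \<open>P\<close>
  is constant, and a triangular idempotent with diagonal \<open>0\<close> or \<open>1\<close> throughout is \<open>0\<close> or \<open>I\<close>.
\<close>

section \<open>Hilbert spaces on carriers\<close>

interpretation complex_vs: vector_space "scaleC :: complex \<Rightarrow> 'a \<Rightarrow> 'a::complex_vector"
  by (rule vector_space_scaleC)

locale hilbert =
  fixes H :: "'a::complex_vector hspace"
  assumes hilbert: "hilbert_space H"
begin

lemma subspace_carrier: "complex_vs.subspace (carrier H)"
  using hilbert unfolding hilbert_space_def by blast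

lemma zero_mem [simp]: "0 \<in> carrier H"
  by (rule complex_vs.subspace_0[OF subspace_carrier])

lemma add_mem [simp]: "x \<in> carrier H \<Longrightarrow> y \<in> carrier H \<Longrightarrow> x + y \<in> carrier H"
  by (rule complex_vs.subspace_add[OF subspace_carrier])

lemma diff_mem [simp]: "x \<in> carrier H \<Longrightarrow> y \<in> carrier H \<Longrightarrow> x - y \<in> carrier H"
  by (rule complex_vs.subspace_diff[OF subspace_carrier])

lemma scale_mem [simp]: "x \<in> carrier H \<Longrightarrow> c *\<^sub>C x \<in> carrier H"
  by (rule complex_vs.subspace_scale[OF subspace_carrier])

lemma sum_mem: "(\<And>i. i \<in> A \<Longrightarrow> f i \<in> carrier H) \<Longrightarrow> sum f A \<in> carrier H"
  by (rule complex_vs.subspace_sum[OF subspace_carrier])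

lemma ip_add_left:
  "x \<in> carrier H \<Longrightarrow> y \<in> carrier H \<Longrightarrow> z \<in> carrier H \<Longrightarrow> ip H (x + y) z = ip H x z + ip H y z"
  using hilbert unfolding hilbert_space_def by blast

lemma ip_scale_left:
  "x \<in> carrier H \<Longrightarrow> y \<in> carrier H \<Longrightarrow> ip H (c *\<^sub>C x) y = c * ip H x y"
  using hilbert unfolding hilbert_space_def by blast

lemma ip_commute: "x \<in> carrier H \<Longrightarrow> y \<in> carrier H \<Longrightarrow> ip H y x = cnj (ip H x y)"
  using hilbert unfolding hilbert_space_def by blast

lemma ip_pos: "x \<in> carrier H \<Longrightarrow> x \<noteq> 0 \<Longrightarrow> Re (ip H x x) > 0"
  using hilbert unfolding hilbert_space_def by blast

lemma ip_zero_left: "y \<in> carrier H \<Longrightarrow> ip H 0 y = 0"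
  using ip_scale_left[of 0 y 0] by simp

lemma ip_diff_left:
  assumes "x \<in> carrier H" "y \<in> carrier H" "z \<in> carrier H"
  shows "ip H (x - y) z = ip H x z - ip H y z"
  using ip_add_left[of "x - y" y z] assms by simp

lemma ip_add_right:
  "x \<in> carrier H \<Longrightarrow> y \<in> carrier H \<Longrightarrow> z \<in> carrier H \<Longrightarrow> ip H z (x + y) = ip H z x + ip H z y"
  using ip_add_left[of x y z] ip_commute[of "x + y" z] ip_commute[of x z] ip_commute[of y z] by simp

lemma ip_scale_right:
  "x \<in> carrier H \<Longrightarrow> y \<in> carrier H \<Longrightarrow> ip H y (c *\<^sub>C x) = cnj c * ip H y x"
  using ip_scale_left[of x y c] ip_commute[of "c *\<^sub>C x" y] ip_commute[of x y] by simp

lemma ip_diff_right: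
  assumes "x \<in> carrier H" "y \<in> carrier H" "z \<in> carrier H"
  shows "ip H z (x - y) = ip H z x - ip H z y"
  using ip_add_right[of "x - y" y z] assms by simp

lemma ip_sum_left:
  assumes "\<And>i. i \<in> A \<Longrightarrow> f i \<in> carrier H" "y \<in> carrier H"
  shows "ip H (sum f A) y = (\<Sum>i\<in>A. ip H (f i) y)"
  using assms(1)
proof (induction A rule: infinite_finite_induct)
  case (insert a A)
  then show ?case
    using assms(2) by (simp add: ip_add_left sum_mem)
qed (use assms(2) in \<open>simp_all add: ip_zero_left\<close>)

lemma ip_sum_right:
  assumes "\<And>i. i \<in> A \<Longrightarrow> f i \<in> carrier H" "y \<in> carrier H"
  shows "ip H y (sum f A) = (\<Sum>i\<in>A. ip H y (f i))"
  using assms by (simp add: ip_commute[of _ y] ip_sum_left sum_mem)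

lemma ip_self:
  assumes "x \<in> carrier H"
  shows "ip H x x = of_real ((hnorm H x)\<^sup>2)"
proof -
  have "Im (ip H x x) = 0"
    using ip_commute[OF assms assms] by (metis cnj.simps(2) equal_neg_zero)
  moreover have "Re (ip H x x) \<ge> 0"
    using ip_pos[OF assms] ip_zero_left[OF zero_mem] by (cases "x = 0") auto
  ultimately show ?thesis
    by (simp add: hnorm_def complex_eq_iff)
qed

lemma hnorm_nonneg: "x \<in> carrier H \<Longrightarrow> hnorm H x \<ge> 0"
  using ip_pos[of x] ip_zero_left[OF zero_mem] by (cases "x = 0") (auto simp: hnorm_def)

lemma hnorm_zero: "hnorm H 0 = 0"
  using ip_zero_left[OF zero_mem] by (simp add: hnorm_def)

lemma hnorm_eq_zero: "x \<in> carrier H \<Longrightarrow> hnorm H x = 0 \<Longrightarrow> x = 0"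
  using ip_pos[of x] by (auto simp: hnorm_def)

lemma hnorm_scale: "x \<in> carrier H \<Longrightarrow> hnorm H (c *\<^sub>C x) = cmod c * hnorm H x"
proof -
  assume x: "x \<in> carrier H"
  have "complex_of_real ((hnorm H (c *\<^sub>C x))\<^sup>2) = (c * cnj c) * of_real ((hnorm H x)\<^sup>2)"
    using x by (simp only: ip_self[symmetric] scale_mem ip_scale_left ip_scale_right) simp
  also have "\<dots> = of_real ((cmod c * hnorm H x)\<^sup>2)"
    by (simp add: complex_norm_square[symmetric] power_mult_distrib)
  finally have "complex_of_real ((hnorm H (c *\<^sub>C x))\<^sup>2) = of_real ((cmod c * hnorm H x)\<^sup>2)" .
  then have "(hnorm H (c *\<^sub>C x))\<^sup>2 = (cmod c * hnorm H x)\<^sup>2"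
    using of_real_eq_iff by blast
  then show ?thesis
    using x by (simp add: hnorm_nonneg)
qed

lemma hnorm_minus_commute:
  assumes "x \<in> carrier H" "y \<in> carrier H"
  shows "hnorm H (x - y) = hnorm H (y - x)"
  using hnorm_scale[of "y - x" "-1"] assms
  by (simp add: complex_vs.scale_minus_left scaleC_one)

lemma Cauchy_Schwarz:
  assumes x: "x \<in> carrier H" and y: "y \<in> carrier H"
  shows "cmod (ip H x y) \<le> hnorm H x * hnorm H y"
proof (cases "hnorm H y = 0")
  case True
  then show ?thesis
    using hnorm_eq_zero[OF y True] ip_scale_right[OF zero_mem x, of 0] by simp
next
  case False
  define b where "b = (hnorm H y)\<^sup>2"
  have b: "b > 0"
    using False by (simp add: b_def)
  define t where "t = ip H x y / of_real b"
  define z where "z = x - t *\<^sub>C y"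
  have z: "z \<in> carrier H"
    using x y by (simp add: z_def)
  have "ip H z z = ip H x x - cnj t * ip H x y - t * ip H y x + t * cnj t * ip H y y"
    using x y
    by (simp add: z_def ip_diff_left ip_diff_right ip_scale_left ip_scale_right algebra_simps)
  also have "\<dots> = of_real ((hnorm H x)\<^sup>2) - cnj t * ip H x y - t * ip H y x + t * cnj t * of_real b"
    using x y by (simp add: ip_self b_def)
  also have "\<dots> = of_real ((hnorm H x)\<^sup>2) - of_real ((cmod (ip H x y))\<^sup>2 / b)"
  proof -
    define q where "q = ip H x y"
    have q: "q * cnj q = of_real ((cmod q)\<^sup>2)"
      by (rule complex_norm_square[symmetric])
    have "cnj t * q = (q * cnj q) / of_real b" "t * cnj q = (q * cnj q) / of_real b"
      "t * cnj t * of_real b = (q * cnj q) / of_real b"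
      using b by (simp_all add: t_def q_def[symmetric])
    then show ?thesis
      using ip_commute[OF x y] by (simp only: q q_def[symmetric]) simp
  qed
  finally have "of_real ((hnorm H z)\<^sup>2) = complex_of_real ((hnorm H x)\<^sup>2 - (cmod (ip H x y))\<^sup>2 / b)"
    using ip_self[OF z] by simp
  then have "(hnorm H z)\<^sup>2 = (hnorm H x)\<^sup>2 - (cmod (ip H x y))\<^sup>2 / b"
    using of_real_eq_iff by blast
  then have "(cmod (ip H x y))\<^sup>2 / b \<le> (hnorm H x)\<^sup>2"
    using zero_le_power2[of "hnorm H z"] by linarith
  then have "(cmod (ip H x y))\<^sup>2 \<le> (hnorm H x * hnorm H y)\<^sup>2"
    using b by (simp add: divide_simps b_def power_mult_distrib)
  then show ?thesis
    using x y by (auto intro: power2_le_imp_le simp: hnorm_nonneg)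
qed

lemma hnorm_triangle:
  assumes x: "x \<in> carrier H" and y: "y \<in> carrier H"
  shows "hnorm H (x + y) \<le> hnorm H x + hnorm H y"
proof -
  have "(hnorm H (x + y))\<^sup>2 = Re (ip H (x + y) (x + y))"
    using x y by (simp add: ip_self)
  also have "ip H (x + y) (x + y) = ip H x x + ip H y y + ip H x y + ip H y x"
    using x y by (simp add: ip_add_left ip_add_right)
  also have "Re \<dots> = (hnorm H x)\<^sup>2 + (hnorm H y)\<^sup>2 + Re (ip H x y) + Re (ip H y x)"
    using x y by (simp add: ip_self)
  also have "\<dots> \<le> (hnorm H x)\<^sup>2 + (hnorm H y)\<^sup>2 + 2 * (hnorm H x * hnorm H y)"
    using Cauchy_Schwarz[OF x y] Cauchy_Schwarz[OF y x]
      complex_Re_le_cmod[of "ip H x y"] complex_Re_le_cmod[of "ip H y x"]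
    by (simp add: mult.commute)
  also have "\<dots> = (hnorm H x + hnorm H y)\<^sup>2"
    by (simp add: power2_sum)
  finally show ?thesis
    using x y by (auto intro: power2_le_imp_le simp: hnorm_nonneg)
qed

lemma hnorm_sum:
  assumes "\<And>i. i \<in> A \<Longrightarrow> f i \<in> carrier H"
  shows "hnorm H (sum f A) \<le> (\<Sum>i\<in>A. hnorm H (f i))"
  using assms
proof (induction A rule: infinite_finite_induct)
  case (insert a A)
  have "hnorm H (f a + sum f A) \<le> hnorm H (f a) + hnorm H (sum f A)"
    using insert by (intro hnorm_triangle) (auto intro: sum_mem)
  with insert show ?case
    by fastforce
qed (simp_all add: hnorm_zero)

lemma complete:
  assumes "\<And>k. X k \<in> carrier H" "\<And>e. e > 0 \<Longrightarrow> \<exists>M::nat. \<forall>k\<ge>M. \<forall>l\<ge>M. hnorm H (X k - X l) < e"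
  obtains x where "x \<in> carrier H" "(\<lambda>k. hnorm H (X k - x)) \<longlonglongrightarrow> 0"
  using hilbert assms unfolding hilbert_space_def by blast

lemma tendsto_ip_left:
  assumes X: "\<And>k. X k \<in> carrier H" "x \<in> carrier H" "(\<lambda>k. hnorm H (X k - x)) \<longlonglongrightarrow> 0"
    and y: "y \<in> carrier H"
  shows "(\<lambda>k. ip H (X k) y) \<longlonglongrightarrow> ip H x y"
proof -
  have "(\<lambda>k. hnorm H (X k - x) * hnorm H y) \<longlonglongrightarrow> 0"
    using tendsto_mult_right[OF X(3), of "hnorm H y"] by simp
  then have "(\<lambda>k. ip H (X k) y - ip H x y) \<longlonglongrightarrow> 0"
    by (rule Lim_null_comparison[rotated])
       (use X y Cauchy_Schwarz in \<open>auto simp: ip_diff_left[symmetric]\<close>)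
  then show ?thesis
    by (simp add: LIM_zero_iff)
qed

lemma tendsto_ip_right:
  assumes X: "\<And>k. X k \<in> carrier H" "x \<in> carrier H" "(\<lambda>k. hnorm H (X k - x)) \<longlonglongrightarrow> 0"
    and y: "y \<in> carrier H"
  shows "(\<lambda>k. ip H y (X k)) \<longlonglongrightarrow> ip H y x"
  using tendsto_cnj[OF tendsto_ip_left[OF X y]] X y by (simp add: ip_commute[of _ y])

end

section \<open>The Taylor coefficients of the kernel\<close>

definition kcoeff :: "real \<Rightarrow> nat \<Rightarrow> real"
  where "kcoeff l k = pochhammer l k / fact k"

lemma kcoeff_0 [simp]: "kcoeff l 0 = 1"
  by (simp add: kcoeff_def)

lemma kcoeff_Suc: "kcoeff l (Suc k) = kcoeff l k * ((l + real k) / real (Suc k))"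
  by (simp add: kcoeff_def pochhammer_Suc)

lemma kcoeff_pos: "l > 0 \<Longrightarrow> kcoeff l k > 0"
  by (simp add: kcoeff_def pochhammer_pos)

lemma kcoeff_sums:
  fixes x :: complex
  assumes "cmod x < 1"
  shows "(\<lambda>k. of_real (kcoeff l k) * x ^ k) sums ((1 - x) powr (- of_real l))"
proof -
  have "((- of_real l) gchoose k) * (- x) ^ k = of_real (kcoeff l k) * x ^ k" for k
  proof -
    have "((- complex_of_real l) gchoose k) * (- x) ^ k
        = ((-1) ^ k * (-1) ^ k) * (pochhammer (of_real l) k / fact k * x ^ k)"
      unfolding gbinomial_pochhammer power_minus[of x] by simp
    also have "((-1) ^ k * (-1) ^ k) = (1 :: complex)"
      by (simp flip: power_mult_distrib)
    finally show ?thesis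
      by (simp add: kcoeff_def pochhammer_of_real[symmetric] del: pochhammer_of_real)
  qed
  then show ?thesis
    using gen_binomial_complex[of "- x" "- of_real l"] assms by simp
qed

lemma kcoeff_mono: "0 < l \<Longrightarrow> l \<le> l' \<Longrightarrow> kcoeff l k \<le> kcoeff l' k"
proof (induction k)
  case (Suc k)
  then show ?case
    using kcoeff_pos[of l k] unfolding kcoeff_Suc
    by (intro mult_mono divide_right_mono) auto
qed simp

lemma kcoeff_add_le:
  assumes "0 < l"
  shows "kcoeff l (k + s) \<le> (max 1 l) ^ s * kcoeff l k"
proof (induction s)
  case (Suc s)
  have "(l + real (k + s)) / real (Suc (k + s)) \<le> max 1 l"
  proof -
    have "l + real (k + s) \<le> max 1 l * 1 + max 1 l * real (k + s)"
      by (intro add_mono mult_right_le_one_le) (auto simp: mult_le_cancel_right1)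
    then show ?thesis
      by (simp add: divide_simps algebra_simps)
  qed
  then have "kcoeff l (k + Suc s) \<le> kcoeff l (k + s) * max 1 l"
    unfolding add_Suc_right kcoeff_Suc
    using kcoeff_pos[OF assms, of "k + s"] by (intro mult_left_mono) auto
  also have "\<dots> \<le> (max 1 l ^ s * kcoeff l k) * max 1 l"
    using Suc by (intro mult_right_mono) auto
  finally show ?case
    by (simp add: mult_ac)
qed simp

text \<open>
  The quotient of the two coefficients is the product of the factors \<open>1 + (q - p) / (p + j)\<close>, which
  is at least \<open>1\<close> plus \<open>q - p\<close> times a partial sum of a harmonic series.
\<close>

lemma kcoeff_ratio_unbounded:
  assumes "0 < p" "p < q"
  obtains k where "kcoeff q k > C * kcoeff p k"
proof -
  define S where "S m = (\<Sum>j<m. 1 / (p + real j))" for m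
  have low: "kcoeff q m \<ge> (1 + (q - p) * S m) * kcoeff p m" for m
  proof (induction m)
    case (Suc m)
    let ?r = "1 + (q - p) / (p + real m)"
    have S: "S m \<ge> 0"
      unfolding S_def using assms by (intro sum_nonneg) auto
    let ?d = "(q - p) / (p + real m)"
    have prod: "1 + (q - p) * S m + ?d \<le> (1 + (q - p) * S m) * (1 + ?d)"
      using S assms by (simp only: distrib_left distrib_right) simp
    have "(1 + (q - p) * S (Suc m)) * kcoeff p (Suc m)
        = (1 + (q - p) * S m + (q - p) / (p + real m)) * kcoeff p (Suc m)"
      by (simp add: S_def algebra_simps)
    also have "\<dots> \<le> ((1 + (q - p) * S m) * ?r) * kcoeff p (Suc m)"
      using prod assms kcoeff_pos[of p "Suc m"] by (intro mult_right_mono) auto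
    also have "\<dots> = ((1 + (q - p) * S m) * kcoeff p m) * (?r * (p + real m) / real (Suc m))"
      by (simp add: kcoeff_Suc)
    also have "?r * (p + real m) = q + real m"
      using assms by (simp add: field_simps)
    also have "((1 + (q - p) * S m) * kcoeff p m) * ((q + real m) / real (Suc m))
       \<le> kcoeff q m * ((q + real m) / real (Suc m))"
      using Suc assms by (intro mult_right_mono) auto
    finally show ?case
      by (simp add: kcoeff_Suc)
  qed (simp add: S_def)
  have "\<not> summable (\<lambda>j. 1 / (p + real j))"
  proof
    assume "summable (\<lambda>j. 1 / (p + real j))"
    then have "summable (\<lambda>j. max 1 p * (1 / (p + real j)))"
      by (rule summable_mult)
    moreover have "norm (1 / real (Suc j)) \<le> max 1 p * (1 / (p + real j))" for j
    proof -
      have "p + real j \<le> max 1 p * 1 + max 1 p * real j"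
        by (intro add_mono) (auto simp: mult_le_cancel_right1)
      then show ?thesis
        using assms by (simp add: divide_simps algebra_simps)
    qed
    ultimately have "summable (\<lambda>j. 1 / real (Suc j))"
      by (rule summable_comparison_test'[where N = 0])
    then show False
      using not_summable_harmonic[where 'a = real] summable_Suc_iff[of "\<lambda>n. 1 / real n"]
      by (simp add: inverse_eq_divide)
  qed
  then have "\<exists>m. S m > C / (q - p)"
  proof (rule contrapos_np)
    assume "\<not> (\<exists>m. S m > C / (q - p))"
    then have "(\<Sum>j\<le>m. 1 / (p + real j)) \<le> C / (q - p)" for m
      unfolding S_def not_ex not_less lessThan_Suc_atMost[symmetric] by blast
    then show "summable (\<lambda>j. 1 / (p + real j))"
      using assms by (intro bounded_imp_summable) auto
  qed
  then obtain m where "S m > C / (q - p)"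
    by blast
  then have "1 + (q - p) * S m > C"
    using assms by (simp add: field_simps)
  then have "C * kcoeff p m < (1 + (q - p) * S m) * kcoeff p m"
    using assms by (simp add: kcoeff_pos)
  with low[of m] show ?thesis
    using that[of m] by linarith
qed

text \<open>
  This is why \<open>m\<close> differentiations of an atom are paid for by raising the weight by \<open>2 m\<close>. By the
  product rule for Pochhammer symbols, \<open>(l)\<^sub>2\<^sub>m\<close> times the \<open>k\<close>-th coefficient for the weight \<open>l + 2 m\<close>
  is \<open>(l)\<^sub>k\<^sub>+\<^sub>m (l + k + m)\<^sub>m / k!\<close>, and as \<open>m \<ge> 1\<close> the second factor is at least
  \<open>(k + 1)\<^sub>m = (k + m)! / k!\<close>.
\<close>

lemma kcoeff_derivative_bound:
  assumes "0 < l" "1 \<le> m" "l + 2 * real m \<le> l'"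
  shows "kcoeff l (k + m) * (fact (k + m) / fact k)\<^sup>2 \<le> pochhammer l (2 * m) * kcoeff l' k"
proof -
  have f: "fact (k + m) / fact k = pochhammer (1 + real k) m"
  proof -
    have "(fact (k + m) :: real) = fact k * pochhammer (1 + real k) m"
      using pochhammer_product'[of "1::real" k m] by (simp only: pochhammer_fact)
    then show ?thesis
      by simp
  qed
  have le: "pochhammer (1 + real k) m \<le> pochhammer (l + real (k + m)) m"
    unfolding pochhammer_prod using assms by (intro prod_mono) auto
  have "kcoeff l (k + m) * (fact (k + m) / fact k)\<^sup>2
      = pochhammer l (k + m) * (fact (k + m) / fact k) / fact k"
    by (simp add: kcoeff_def power2_eq_square)
  also have "\<dots> \<le> pochhammer l (k + m) * pochhammer (l + real (k + m)) m / fact k"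
    unfolding f using le assms by (intro divide_right_mono mult_left_mono) (auto simp: pochhammer_nonneg)
  also have "\<dots> = pochhammer l (2 * m + k) / fact k"
  proof -
    have "2 * m + k = k + m + m"
      by simp
    then show ?thesis
      by (simp only: pochhammer_product'[of l "k + m" m])
  qed
  also have "\<dots> = pochhammer l (2 * m) * kcoeff (l + 2 * real m) k"
    using pochhammer_product'[of l "2 * m" k] by (simp add: kcoeff_def)
  also have "\<dots> \<le> pochhammer l (2 * m) * kcoeff l' k"
    using assms by (intro mult_left_mono kcoeff_mono pochhammer_nonneg) auto
  finally show ?thesis .
qed

text \<open>
  The converse estimate for one differentiation: the price \<open>2\<close> cannot be lowered.
\<close>

lemma kcoeff_derivative_lower_bound:
  assumes "0 < l"
  shows "l * kcoeff (l + 2) m \<le> (real (Suc m))\<^sup>2 * kcoeff l (Suc m)"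
proof -
  have "(l + real (Suc m)) * pochhammer l (Suc m) = l * (l + 1) * pochhammer (l + 2) m"
    using pochhammer_rec'[of l "Suc m"] pochhammer_rec[of l "Suc m"] pochhammer_rec[of "l + 1" m]
    by (simp add: algebra_simps)
  then have e: "(l + real (Suc m)) * (real (Suc m) * kcoeff l (Suc m)) = l * (l + 1) * kcoeff (l + 2) m"
    by (simp add: kcoeff_def divide_simps)
  have "(l + real (Suc m)) * (l * kcoeff (l + 2) m) \<le> (l + 1) * real (Suc m) * (l * kcoeff (l + 2) m)"
    using assms kcoeff_pos[of "l + 2" m] by (intro mult_right_mono) (auto simp: algebra_simps)
  also have "\<dots> = real (Suc m) * (l * (l + 1) * kcoeff (l + 2) m)"
    by simp
  also have "\<dots> = (l + real (Suc m)) * ((real (Suc m))\<^sup>2 * kcoeff l (Suc m))"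
    unfolding e[symmetric] by (simp add: power2_eq_square)
  finally show ?thesis
    using assms by (simp add: mult_le_cancel_left_pos)
qed

section \<open>Moment coordinates\<close>

text \<open>
  The coefficients of a power series can be peeled off one after the other by limits at \<open>0\<close>. This
  gives their uniqueness, and later the monomials as limits of combinations of kernel functions.
\<close>

lemma powser_remainder_tendsto:
  fixes f :: "complex \<Rightarrow> complex"
  assumes "\<And>z. z \<in> \<D> \<Longrightarrow> (\<lambda>k. c k * z ^ k) sums f z"
  shows "((\<lambda>z. (f z - (\<Sum>m<k. c m * z ^ m)) / z ^ k) \<longlongrightarrow> c k) (at 0)"
proof -
  have "((\<lambda>z. (f z - (\<Sum>m<k. c m * z ^ m)) / z ^ k) \<longlongrightarrow> c (0 + k)) (at 0)"
  proof (rule powser_limit_0_strong[where s = 1])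
    fix z :: complex
    assume z: "z \<noteq> 0" "norm z < 1"
    have "(\<lambda>j. c (j + k) * z ^ (j + k) / z ^ k) sums ((f z - (\<Sum>m<k. c m * z ^ m)) / z ^ k)"
      using z by (intro sums_divide sums_split_initial_segment assms) simp
    then show "(\<lambda>j. c (j + k) * z ^ j) sums ((f z - (\<Sum>m<k. c m * z ^ m)) / z ^ k)"
      using z by (simp add: power_add)
  qed simp
  then show ?thesis
    by simp
qed

lemma powser_coeff_unique:
  fixes f :: "complex \<Rightarrow> complex"
  assumes "\<And>z. z \<in> \<D> \<Longrightarrow> (\<lambda>k. c k * z ^ k) sums f z"
    and "\<And>z. z \<in> \<D> \<Longrightarrow> (\<lambda>k. d k * z ^ k) sums f z"
  shows "c k = d k"
proof (induction k rule: less_induct)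
  case (less k)
  have "(\<Sum>m<k. c m * z ^ m) = (\<Sum>m<k. d m * z ^ m)" for z
    using less by (intro sum.cong) auto
  then show ?case
    using powser_remainder_tendsto[OF assms(1), of k] powser_remainder_tendsto[OF assms(2), of k]
    by (auto intro: tendsto_unique[OF trivial_limit_at])
qed

lemma sum_fun_apply: "sum f A x = (\<Sum>i\<in>A. f i x)"
  for f :: "'i \<Rightarrow> 'a \<Rightarrow> 'b::comm_monoid_add"
  by (induction A rule: infinite_finite_induct) simp_all

lemma scaleC_apply [simp]: "(c *\<^sub>C f) x = c *\<^sub>C f x"
  by (simp add: scaleC_fun_def)

lemma scaleC_complex_eq [simp]: "c *\<^sub>C (x :: complex) = c * x"
  by (simp add: scaleC_complex_def)

definition monomial :: "nat \<Rightarrow> complex \<Rightarrow> complex"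
  where "monomial k = on_domain \<D> (\<lambda>z. z ^ k)"

text \<open>
  Moments are the coordinates used throughout. Compared with Taylor coefficients they lack the
  factors \<open>kcoeff l k\<close>, so that the atom with parameter \<open>w\<close> has the moments \<open>w ^ k\<close> whatever the
  weight is, and the adjoint of multiplication by the coordinate becomes the plain shift.
\<close>

definition moment :: "(complex \<Rightarrow> complex) hspace \<Rightarrow> (complex \<Rightarrow> complex) \<Rightarrow> nat \<Rightarrow> complex"
  where "moment H f k = ip H f (monomial k)"

definition from_moments :: "real \<Rightarrow> (nat \<Rightarrow> complex) \<Rightarrow> complex \<Rightarrow> complex"
  where "from_moments l d = on_domain \<D> (\<lambda>z. \<Sum>k. of_real (kcoeff l k) * d k * z ^ k)"

text \<open>
  The normalisation makes the moments of \<open>basis_vec l k\<close> those of a unit sequence; its squared norm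
  is then \<open>kcoeff l k\<close>.
\<close>

definition basis_vec :: "real \<Rightarrow> nat \<Rightarrow> complex \<Rightarrow> complex"
  where "basis_vec l k = of_real (kcoeff l k) *\<^sub>C monomial k"

locale weighted_space =
  fixes l :: real and H :: "(complex \<Rightarrow> complex) hspace"
  assumes pos: "0 < l" and A_space: "is_A_space l H"
begin

sublocale hilbert H
  using A_space by unfold_locales (simp add: is_A_space_def)

definition kern :: "complex \<Rightarrow> complex \<Rightarrow> complex"
  where "kern w = on_domain \<D> (\<lambda>z. (1 - z * cnj w) powr (- of_real l))"

lemma kern_mem: "w \<in> \<D> \<Longrightarrow> kern w \<in> carrier H"
  using A_space by (simp add: is_A_space_def has_reproducing_kernel_def kern_def)

lemma reproducing: "w \<in> \<D> \<Longrightarrow> f \<in> carrier H \<Longrightarrow> ip H f (kern w) = f w"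
  using A_space by (simp add: is_A_space_def has_reproducing_kernel_def kern_def)

lemma zero_outside: "f \<in> carrier H \<Longrightarrow> z \<notin> \<D> \<Longrightarrow> f z = 0"
proof -
  assume f: "f \<in> carrier H" and z: "z \<notin> \<D>"
  have "on_domain \<D> f = f"
    using A_space f unfolding is_A_space_def has_reproducing_kernel_def by blast
  then have "on_domain \<D> f z = f z"
    by simp
  then show ?thesis
    using z by (simp add: on_domain_def)
qed

lemma has_powser:
  assumes "f \<in> carrier H"
  obtains c where "\<And>z. z \<in> \<D> \<Longrightarrow> (\<lambda>k. c k * z ^ k) sums f z"
proof -
  have "f holomorphic_on \<D>"
    using A_space assms by (simp add: is_A_space_def)
  then have "(\<lambda>k. (deriv ^^ k) f 0 / fact k * z ^ k) sums f z" if "z \<in> \<D>" for z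
    using holomorphic_power_series[of f 0 1 z] that by simp
  then show ?thesis
    by (rule that)
qed

lemma kern_sums:
  assumes "z \<in> \<D>" "w \<in> \<D>"
  shows "(\<lambda>k. (of_real (kcoeff l k) * cnj w ^ k) * z ^ k) sums kern w z"
proof -
  have "cmod z * cmod w < 1 * 1"
    using assms by (intro mult_strict_mono) auto
  then have "(\<lambda>k. of_real (kcoeff l k) * (z * cnj w) ^ k) sums (1 - z * cnj w) powr (- of_real l)"
    by (intro kcoeff_sums) (simp add: norm_mult)
  then show ?thesis
    using assms(1) by (simp add: kern_def on_domain_def power_mult_distrib mult_ac)
qed

lemma kcoeff_ne_0 [simp]: "kcoeff l k \<noteq> 0"
  using kcoeff_pos[OF pos, of k] by simp

text \<open>
  The reproducing kernel only provides kernel functions, and the monomials have to be extracted from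
  them. By induction, subtract from the kernel function at a real point \<open>r\<close> its first \<open>k\<close> Taylor
  terms, which lie in the space, and divide by \<open>r ^ k\<close>. The inner product of \<open>f\<close> with the result is
  the \<open>k\<close>-th Taylor remainder of \<open>f\<close> at \<open>r\<close> divided by \<open>r ^ k\<close>, and tends to the \<open>k\<close>-th coefficient of
  \<open>f\<close>. Applied to the quotients themselves, this shows that they form a Cauchy family as \<open>r\<close> tends
  to \<open>0\<close>; evaluating the limit by the kernel identifies it as \<open>kcoeff l k\<close> times the monomial.
\<close>

lemma monomial_mem_and_moment:
  "monomial k \<in> carrier H \<and>
   (\<forall>f c. f \<in> carrier H \<longrightarrow> (\<forall>z\<in>\<D>. (\<lambda>k. c k * z ^ k) sums f z) \<longrightarrow>
      of_real (kcoeff l k) * ip H f (monomial k) = c k)"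
proof (induction k rule: less_induct)
  case (less k)
  have mem: "monomial m \<in> carrier H" if "m < k" for m
    using less that by blast
  have coeff: "of_real (kcoeff l m) * ip H f (monomial m) = c m"
    if "m < k" "f \<in> carrier H" "\<And>z. z \<in> \<D> \<Longrightarrow> (\<lambda>k. c k * z ^ k) sums f z" for f c m
    using less that by blast
  define a where "a m = complex_of_real (kcoeff l m)" for m
  define r where "r N = inverse (real (Suc (Suc N)))" for N :: nat
  define h where "h s = (1 / of_real s ^ k) *\<^sub>C
      (kern (of_real s) - (\<Sum>m<k. (a m * of_real s ^ m) *\<^sub>C monomial m))" for s :: real
  have r: "0 < r N" "r N < 1" for N
    by (auto simp: r_def inverse_less_1_iff)
  have rD: "complex_of_real (r N) \<in> \<D>" for N
    using r[of N] by simp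
  have h_mem: "h (r N) \<in> carrier H" for N
    unfolding h_def using rD by (intro scale_mem diff_mem sum_mem kern_mem mem) auto
  have ip_h: "ip H f (h (r N)) = (f (of_real (r N)) - (\<Sum>m<k. c m * of_real (r N) ^ m)) / of_real (r N) ^ k"
    if f: "f \<in> carrier H" and c: "\<And>z. z \<in> \<D> \<Longrightarrow> (\<lambda>k. c k * z ^ k) sums f z" for f c N
  proof -
    have sm: "(\<Sum>m<k. (a m * of_real (r N) ^ m) *\<^sub>C monomial m) \<in> carrier H"
      by (intro sum_mem scale_mem mem) auto
    have "ip H f (\<Sum>m<k. (a m * of_real (r N) ^ m) *\<^sub>C monomial m)
        = (\<Sum>m<k. of_real (r N) ^ m * (a m * ip H f (monomial m)))"
      using f mem by (subst ip_sum_right) (auto simp: ip_scale_right a_def mult_ac intro!: sum.cong)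
    also have "\<dots> = (\<Sum>m<k. c m * of_real (r N) ^ m)"
      using coeff[OF _ f c] by (intro sum.cong) (simp_all add: a_def)
    finally show ?thesis
      unfolding h_def using f sm kern_mem[OF rD] reproducing[OF rD f]
      by (simp add: ip_scale_right ip_diff_right)
  qed
  \<comment> \<open>The inner products of the approximants are remainders of the kernel function itself.\<close>
  define K where "K x = (1 - x) powr (- complex_of_real l)" for x
  define G where "G x = (K x - (\<Sum>m<k. a m * x ^ m)) / x ^ k" for x
  have K_sums: "(\<lambda>k. a k * z ^ k) sums K z" if "z \<in> \<D>" for z
    using kcoeff_sums[of z l] that by (simp add: K_def a_def)
  have G_lim: "(G \<longlongrightarrow> a k) (at 0)"
    unfolding G_def by (rule powser_remainder_tendsto) (rule K_sums)
  have ip_hh: "ip H (h (r M)) (h (r N)) = G (of_real (r M * r N))" for M N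
  proof -
    define c where "c j = (if j < k then 0 else a j * of_real (r M) ^ (j - k))" for j
    have sums: "(\<lambda>j. c j * z ^ j) sums h (r M) z" if z: "z \<in> \<D>" for z
    proof -
      let ?t = "\<lambda>j. a j * of_real (r M) ^ j * z ^ j"
      have "?t sums kern (of_real (r M)) z"
        using kern_sums[OF z rD] by (simp add: a_def)
      moreover have "(\<lambda>j. if j \<in> {..<k} then ?t j else 0) sums sum ?t {..<k}"
        by (rule sums_If_finite_set) simp
      ultimately have "(\<lambda>j. (1 / of_real (r M) ^ k) * (?t j - (if j \<in> {..<k} then ?t j else 0)))
          sums ((1 / of_real (r M) ^ k) * (kern (of_real (r M)) z - sum ?t {..<k}))"
        by (intro sums_mult sums_diff)
      moreover have "(1 / of_real (r M) ^ k) * (?t j - (if j \<in> {..<k} then ?t j else 0)) = c j * z ^ j" for j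
        using r[of M] by (auto simp: c_def power_diff)
      moreover have "(1 / of_real (r M) ^ k) * (kern (of_real (r M)) z - sum ?t {..<k}) = h (r M) z"
        using z by (simp add: h_def sum_fun_apply monomial_def on_domain_def)
      ultimately show ?thesis
        by simp
    qed
    have "ip H (h (r M)) (h (r N)) = h (r M) (of_real (r N)) / of_real (r N) ^ k"
      using ip_h[OF h_mem sums, of N] by (simp add: c_def)
    also have "\<dots> = G (of_real (r M * r N))"
      using rD[of N] r[of M]
      by (simp add: h_def G_def K_def kern_def on_domain_def sum_fun_apply monomial_def
          power_mult_distrib mult_ac)
    finally show ?thesis .
  qed
  have r_lim: "r \<longlonglongrightarrow> 0"
    unfolding r_def by (rule LIMSEQ_Suc[OF LIMSEQ_inverse_real_of_nat])
  have r_lim': "filterlim (\<lambda>N. complex_of_real (r N)) (at 0) sequentially"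
  proof -
    have "complex_of_real (r N) \<noteq> 0" for N
      using r(1)[of N] by simp
    then show ?thesis
      using tendsto_of_real[OF r_lim, where 'a = complex] by (simp add: filterlim_at)
  qed
  have cauchy: "\<exists>M. \<forall>i\<ge>M. \<forall>j\<ge>M. hnorm H (h (r i) - h (r j)) < e" if e: "e > 0" for e
  proof -
    obtain \<delta> where \<delta>: "\<delta> > 0" "\<And>x. x \<noteq> 0 \<Longrightarrow> cmod x < \<delta> \<Longrightarrow> cmod (G x - a k) < e\<^sup>2 / 4"
    proof -
      have "e\<^sup>2 / 4 > 0"
        using e by simp
      moreover have "\<forall>e>0. \<exists>\<delta>>0. \<forall>x. x \<noteq> 0 \<and> cmod x < \<delta> \<longrightarrow> cmod (G x - a k) < e"
        using G_lim unfolding tendsto_iff eventually_at dist_norm by simp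
      ultimately show ?thesis
        using that by blast
    qed
    obtain M where M: "\<And>i. i \<ge> M \<Longrightarrow> r i < \<delta>"
      using order_tendstoD(2)[OF r_lim \<delta>(1)] by (auto simp: eventually_sequentially)
    have G_close: "cmod (G (of_real (r i * r j)) - a k) < e\<^sup>2 / 4" if "i \<ge> M" for i j
    proof -
      have "r i * r j < \<delta> * 1"
        using M[OF that] r[of i] r[of j] by (intro mult_strict_mono) auto
      then show ?thesis
        using r[of i] r[of j] by (intro \<delta>) (auto simp: norm_mult)
    qed
    have "hnorm H (h (r i) - h (r j)) < e" if ij: "i \<ge> M" "j \<ge> M" for i j
    proof -
      have "of_real ((hnorm H (h (r i) - h (r j)))\<^sup>2)
        = G (of_real (r i * r i)) - G (of_real (r i * r j)) - G (of_real (r j * r i)) + G (of_real (r j * r j))"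
        using h_mem by (subst ip_self[symmetric]) (simp_all add: ip_diff_left ip_diff_right ip_hh)
      also have "\<dots> = (G (of_real (r i * r i)) - a k) - (G (of_real (r i * r j)) - a k)
          - (G (of_real (r j * r i)) - a k) + (G (of_real (r j * r j)) - a k)"
        by simp
      finally have "cmod (of_real ((hnorm H (h (r i) - h (r j)))\<^sup>2)) = cmod \<dots>"
        by simp
      also have "\<dots> < e\<^sup>2 / 4 + e\<^sup>2 / 4 + e\<^sup>2 / 4 + e\<^sup>2 / 4"
        using G_close[OF ij(1), of i] G_close[OF ij(1), of j] G_close[OF ij(2), of i] G_close[OF ij(2), of j]
        by norm
      finally have "(hnorm H (h (r i) - h (r j)))\<^sup>2 < e\<^sup>2"
        by (simp del: of_real_power)
      then show ?thesis
        using e by (auto intro: power2_less_imp_less)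
    qed
    then show ?thesis
      by blast
  qed
  obtain x where x: "x \<in> carrier H" and x_lim: "(\<lambda>N. hnorm H (h (r N) - x)) \<longlonglongrightarrow> 0"
    using complete[of "\<lambda>N. h (r N)"] h_mem cauchy by metis
  have ip_x: "ip H f x = c k"
    if f: "f \<in> carrier H" and c: "\<And>z. z \<in> \<D> \<Longrightarrow> (\<lambda>k. c k * z ^ k) sums f z" for f c
  proof (rule LIMSEQ_unique)
    show "(\<lambda>N. ip H f (h (r N))) \<longlonglongrightarrow> ip H f x"
      by (rule tendsto_ip_right[OF h_mem x x_lim f])
    have "ip H f (h (r N)) = (f (of_real (r N)) - (\<Sum>m<k. c m * of_real (r N) ^ m)) / of_real (r N) ^ k" for N
      by (rule ip_h[OF f c])
    then show "(\<lambda>N. ip H f (h (r N))) \<longlonglongrightarrow> c k"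
      using filterlim_compose[OF powser_remainder_tendsto[OF c, of k] r_lim'] by simp
  qed
  have "x = a k *\<^sub>C monomial k"
  proof
    fix w
    show "x w = (a k *\<^sub>C monomial k) w"
    proof (cases "w \<in> \<D>")
      case True
      have "ip H (kern w) x = a k * cnj w ^ k"
        using ip_x[OF kern_mem[OF True] kern_sums[OF _ True]] by (simp add: a_def)
      then show ?thesis
        using reproducing[OF True x] ip_commute[OF kern_mem[OF True] x] True
        by (simp add: monomial_def on_domain_def a_def)
    next
      case False
      then show ?thesis
        using zero_outside[OF x] by (simp add: monomial_def on_domain_def)
    qed
  qed
  then have mono: "monomial k = (1 / a k) *\<^sub>C x"
    by (simp add: a_def scaleC_scaleC scaleC_one)
  have mem_k: "monomial k \<in> carrier H"
    unfolding mono by (rule scale_mem[OF x])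
  have "of_real (kcoeff l k) * ip H f (monomial k) = ip H f x" if "f \<in> carrier H" for f
    using that x unfolding mono by (subst ip_scale_right) (simp_all add: a_def)
  with mem_k ip_x show ?case
    by simp
qed

lemma monomial_mem [simp]: "monomial k \<in> carrier H"
  using monomial_mem_and_moment by blast

lemma moment_coeff:
  assumes "f \<in> carrier H" "\<And>z. z \<in> \<D> \<Longrightarrow> (\<lambda>k. c k * z ^ k) sums f z"
  shows "of_real (kcoeff l k) * moment H f k = c k"
  using monomial_mem_and_moment assms unfolding moment_def by blast

lemma taylor_moment:
  assumes "f \<in> carrier H" "z \<in> \<D>"
  shows "(\<lambda>k. of_real (kcoeff l k) * moment H f k * z ^ k) sums f z"
proof -
  obtain c where c: "\<And>z. z \<in> \<D> \<Longrightarrow> (\<lambda>k. c k * z ^ k) sums f z"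
    using has_powser assms by blast
  have "of_real (kcoeff l k) * moment H f k = c k" for k
    by (rule moment_coeff[OF assms(1) c])
  then show ?thesis
    using c[OF assms(2)] by simp
qed

lemma moment_inject:
  assumes "f \<in> carrier H" "g \<in> carrier H" "\<And>k. moment H f k = moment H g k"
  shows "f = g"
proof
  fix z
  show "f z = g z"
  proof (cases "z \<in> \<D>")
    case True
    then show ?thesis
      using sums_unique2 taylor_moment[of f z] taylor_moment[of g z] assms by simp
  next
    case False
    then show ?thesis
      using zero_outside[OF assms(1) False] zero_outside[OF assms(2) False] by simp
  qed
qed

lemma moment_add: "f \<in> carrier H \<Longrightarrow> g \<in> carrier H \<Longrightarrow> moment H (f + g) k = moment H f k + moment H g k"
  by (simp add: moment_def ip_add_left)

lemma moment_diff: "f \<in> carrier H \<Longrightarrow> g \<in> carrier H \<Longrightarrow> moment H (f - g) k = moment H f k - moment H g k"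
  by (simp add: moment_def ip_diff_left)

lemma moment_scale: "f \<in> carrier H \<Longrightarrow> moment H (c *\<^sub>C f) k = c * moment H f k"
  by (simp add: moment_def ip_scale_left)

lemma moment_zero: "moment H 0 k = 0"
  by (simp add: moment_def ip_zero_left)

lemma basis_mem [simp]: "basis_vec l k \<in> carrier H"
  by (simp add: basis_vec_def)

lemma ip_basis_left: "g \<in> carrier H \<Longrightarrow> ip H (basis_vec l k) g = of_real (kcoeff l k) * cnj (moment H g k)"
  by (simp add: basis_vec_def ip_scale_left moment_def ip_commute[of g "monomial k"])

lemma moment_basis: "moment H (basis_vec l j) k = (if k = j then 1 else 0)"
proof -
  have "(\<lambda>i. (if i = j then of_real (kcoeff l j) else 0) * z ^ i) sums basis_vec l j z" if "z \<in> \<D>" for z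
    using sums_single[of j "\<lambda>i. of_real (kcoeff l j) * z ^ i"] that
    by (simp add: basis_vec_def monomial_def on_domain_def if_distrib[of "\<lambda>x. x * _"] cong: if_cong)
  then have "of_real (kcoeff l k) * moment H (basis_vec l j) k = (if k = j then of_real (kcoeff l j) else 0)"
    by (rule moment_coeff[OF basis_mem])
  then show ?thesis
    by (auto split: if_splits)
qed

lemma hnorm_basis: "(hnorm H (basis_vec l k))\<^sup>2 = kcoeff l k"
proof -
  have "complex_of_real ((hnorm H (basis_vec l k))\<^sup>2) = of_real (kcoeff l k)"
    by (simp only: ip_self[symmetric] basis_mem ip_basis_left moment_basis) simp
  then show ?thesis
    using of_real_eq_iff by blast
qed

definition partial :: "(nat \<Rightarrow> complex) \<Rightarrow> nat \<Rightarrow> complex \<Rightarrow> complex"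
  where "partial d N = (\<Sum>k<N. d k *\<^sub>C basis_vec l k)"

lemma partial_mem [simp]: "partial d N \<in> carrier H"
  unfolding partial_def by (intro sum_mem) simp

lemma ip_partial:
  "g \<in> carrier H \<Longrightarrow> ip H (partial d N) g = (\<Sum>k<N. of_real (kcoeff l k) * d k * cnj (moment H g k))"
  unfolding partial_def by (subst ip_sum_left) (auto simp: ip_scale_left ip_basis_left intro!: sum.cong)

lemma moment_partial: "moment H (partial d N) k = (if k < N then d k else 0)"
proof -
  have "moment H (partial d N) k = (\<Sum>j<N. d j * moment H (basis_vec l j) k)"
    unfolding moment_def partial_def by (subst ip_sum_left) (auto simp: ip_scale_left)
  also have "\<dots> = (\<Sum>j<N. if k = j then d j else 0)"
    by (intro sum.cong) (auto simp: moment_basis)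
  finally show ?thesis
    by simp
qed

lemma hnorm_partial: "(hnorm H (partial d N))\<^sup>2 = (\<Sum>k<N. kcoeff l k * (cmod (d k))\<^sup>2)"
proof -
  have "complex_of_real ((hnorm H (partial d N))\<^sup>2) = (\<Sum>k<N. of_real (kcoeff l k) * (d k * cnj (d k)))"
    by (simp only: ip_self[symmetric] partial_mem ip_partial moment_partial) (auto intro!: sum.cong)
  also have "\<dots> = of_real (\<Sum>k<N. kcoeff l k * (cmod (d k))\<^sup>2)"
    by (simp add: complex_norm_square[symmetric])
  finally show ?thesis
    using of_real_eq_iff by blast
qed

lemma hnorm_partial_diff:
  assumes "M \<le> N"
  shows "(hnorm H (partial d N - partial d M))\<^sup>2 = (\<Sum>k\<in>{M..<N}. kcoeff l k * (cmod (d k))\<^sup>2)"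
proof -
  have "partial d N - partial d M = partial (\<lambda>k. if k < M then 0 else d k) N"
    using assms by (intro moment_inject) (auto simp: moment_diff moment_partial)
  then have "(hnorm H (partial d N - partial d M))\<^sup>2
      = (\<Sum>k<N. if k < M then 0 else kcoeff l k * (cmod (d k))\<^sup>2)"
    by (auto simp: hnorm_partial intro!: sum.cong)
  also have "\<dots> = (\<Sum>k\<in>{M..<N}. kcoeff l k * (cmod (d k))\<^sup>2)"
    by (intro sum.mono_neutral_cong_right) auto
  finally show ?thesis .
qed

text \<open>
  Completeness in the form of the Riesz--Fischer theorem: every admissible sequence is a sequence of
  moments.
\<close>

lemma square_summable_moments:
  assumes sm: "summable (\<lambda>k. kcoeff l k * (cmod (d k))\<^sup>2)"
  obtains f where "f \<in> carrier H" "\<And>k. moment H f k = d k" "(\<lambda>N. hnorm H (partial d N - f)) \<longlonglongrightarrow> 0"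
proof -
  let ?t = "\<lambda>k. kcoeff l k * (cmod (d k))\<^sup>2"
  have "\<exists>M. \<forall>i\<ge>M. \<forall>j\<ge>M. hnorm H (partial d i - partial d j) < e" if e: "e > 0" for e
  proof -
    have "e\<^sup>2 > 0"
      using e by simp
    then obtain M where M: "\<And>m n. m \<ge> M \<Longrightarrow> norm (sum ?t {m..<n}) < e\<^sup>2"
      using sm unfolding summable_Cauchy by meson
    have *: "hnorm H (partial d i - partial d j) < e" if "M \<le> j" "j \<le> i" for i j
    proof -
      have "(hnorm H (partial d i - partial d j))\<^sup>2 < e\<^sup>2"
        using M[OF that(1), of i] by (simp add: hnorm_partial_diff[OF that(2)])
      then show ?thesis
        using e by (auto intro: power2_less_imp_less)
    qed
    have "hnorm H (partial d i - partial d j) < e" if "M \<le> i" "M \<le> j" for i j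
      using *[of j i] *[of i j] that hnorm_minus_commute[of "partial d i" "partial d j"]
      by (cases "j \<le> i") auto
    then show ?thesis
      by blast
  qed
  then obtain f where f: "f \<in> carrier H" "(\<lambda>N. hnorm H (partial d N - f)) \<longlonglongrightarrow> 0"
    using complete[of "partial d"] partial_mem by metis
  have "moment H f k = d k" for k
  proof (rule LIMSEQ_unique)
    show "(\<lambda>N. moment H (partial d N) k) \<longlonglongrightarrow> moment H f k"
      unfolding moment_def by (rule tendsto_ip_left[OF _ f]) simp_all
    show "(\<lambda>N. moment H (partial d N) k) \<longlonglongrightarrow> d k"
      by (rule tendsto_eventually)
         (auto simp: moment_partial eventually_sequentially intro!: exI[of _ "Suc k"])
  qed
  with f that show ?thesis
    by blast
qed

text \<open>
  This is Bessel's inequality: \<open>\<langle>p, f\<rangle> = \<parallel>p\<parallel>\<^sup>2\<close> for each partial sum \<open>p\<close> of the expansion of \<open>f\<close>.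
\<close>

lemma moments_square_summable:
  assumes f: "f \<in> carrier H"
  shows "summable (\<lambda>k. kcoeff l k * (cmod (moment H f k))\<^sup>2)"
proof (rule bounded_imp_summable)
  fix N
  let ?p = "partial (moment H f) (Suc N)"
  have n: "(hnorm H ?p)\<^sup>2 = (\<Sum>k\<le>N. kcoeff l k * (cmod (moment H f k))\<^sup>2)"
    by (simp only: hnorm_partial lessThan_Suc_atMost)
  have "ip H ?p f = of_real ((hnorm H ?p)\<^sup>2)"
    using f by (simp add: ip_partial hnorm_partial mult.assoc complex_norm_square del: of_real_power sum.lessThan_Suc)
  then have "(hnorm H ?p)\<^sup>2 \<le> hnorm H ?p * hnorm H f"
    using Cauchy_Schwarz[of ?p f] f by (simp del: of_real_power add: norm_of_real)
  then have "hnorm H ?p \<le> hnorm H f"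
    using hnorm_nonneg[of ?p] hnorm_nonneg[OF f] by (cases "hnorm H ?p = 0") (auto simp: power2_eq_square)
  then have "(hnorm H ?p)\<^sup>2 \<le> (hnorm H f)\<^sup>2"
    using hnorm_nonneg[of ?p] by (intro power_mono) auto
  then show "(\<Sum>k\<le>N. kcoeff l k * (cmod (moment H f k))\<^sup>2) \<le> (hnorm H f)\<^sup>2"
    by (simp only: n)
qed (use kcoeff_pos[OF pos] in \<open>auto simp: less_imp_le\<close>)

text \<open>
  The partial sums have a limit, which has the moments of \<open>f\<close>; and moments determine the function,
  since they are its Taylor coefficients.
\<close>

lemma partial_tendsto:
  assumes f: "f \<in> carrier H"
  shows "(\<lambda>N. hnorm H (partial (moment H f) N - f)) \<longlonglongrightarrow> 0"
proof -
  obtain g where g: "g \<in> carrier H" "\<And>k. moment H g k = moment H f k"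
    "(\<lambda>N. hnorm H (partial (moment H f) N - g)) \<longlonglongrightarrow> 0"
    using square_summable_moments[OF moments_square_summable[OF f]] by blast
  then have "g = f"
    using f by (intro moment_inject) auto
  with g show ?thesis
    by simp
qed

lemma parseval:
  assumes f: "f \<in> carrier H" and g: "g \<in> carrier H"
  shows "(\<lambda>k. of_real (kcoeff l k) * moment H f k * cnj (moment H g k)) sums ip H f g"
  using tendsto_ip_left[OF partial_mem f partial_tendsto[OF f] g] g
  by (simp add: sums_def ip_partial)

lemma hnorm_sums:
  assumes f: "f \<in> carrier H"
  shows "(\<lambda>k. kcoeff l k * (cmod (moment H f k))\<^sup>2) sums (hnorm H f)\<^sup>2"
proof -
  have "(\<lambda>k. of_real (kcoeff l k * (cmod (moment H f k))\<^sup>2)) sums complex_of_real ((hnorm H f)\<^sup>2)"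
    using parseval[OF f f] f
    by (simp add: ip_self mult.assoc complex_norm_square[symmetric])
  then show ?thesis
    by (simp only: sums_of_real_iff)
qed

lemma
  assumes sm: "summable (\<lambda>k. kcoeff l k * (cmod (d k))\<^sup>2)"
  shows from_moments_mem: "from_moments l d \<in> carrier H"
    and moment_from_moments: "moment H (from_moments l d) k = d k"
proof -
  obtain f where f: "f \<in> carrier H" "\<And>k. moment H f k = d k"
    using square_summable_moments[OF sm] by blast
  have "from_moments l d = f"
  proof
    fix z
    show "from_moments l d z = f z"
      using sums_unique[OF taylor_moment[OF f(1), of z]] zero_outside[OF f(1), of z]
      by (auto simp: from_moments_def on_domain_def f)
  qed
  with f show "from_moments l d \<in> carrier H" "moment H (from_moments l d) k = d k"
    by auto
qed

end

section \<open>Derivatives of atoms, and multiplication by the coordinate\<close>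

lemma kcoeff_geometric_summable:
  assumes "cmod w < 1"
  shows "summable (\<lambda>k. kcoeff l k * (cmod (w ^ k))\<^sup>2)"
proof -
  have "cmod w * cmod w < 1 * 1"
    using assms by (intro mult_strict_mono) auto
  then have "(\<lambda>k. of_real (kcoeff l k) * of_real ((cmod w)\<^sup>2) ^ k) sums
      ((1 - of_real ((cmod w)\<^sup>2)) powr (- complex_of_real l))"
    by (intro kcoeff_sums) (simp add: norm_power power2_eq_square norm_mult)
  then have "summable (\<lambda>k. complex_of_real (kcoeff l k * ((cmod w)\<^sup>2) ^ k))"
    by (simp add: sums_iff)
  then have "summable (\<lambda>k. kcoeff l k * ((cmod w)\<^sup>2) ^ k)"
    by (simp only: summable_of_real_iff)
  then show ?thesis
    by (simp add: norm_power power_mult[symmetric] mult.commute)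
qed

text \<open>
  If \<open>d\<close> is the sequence of powers of \<open>w\<close>, this is its \<open>m\<close>-th derivative in \<open>w\<close>; thus it turns the
  moments of an atom into those of the \<open>m\<close>-th derivative of an atom.
\<close>

definition moments_deriv :: "nat \<Rightarrow> (nat \<Rightarrow> complex) \<Rightarrow> nat \<Rightarrow> complex"
  where "moments_deriv m d k = (if k < m then 0 else of_real (fact k / fact (k - m)) * d (k - m))"

lemma moments_deriv_0 [simp]: "moments_deriv 0 d = d"
  by (simp add: moments_deriv_def fun_eq_iff)

lemma
  assumes l: "0 < l" "1 \<le> m" "l + 2 * real m \<le> l'"
    and sm: "summable (\<lambda>k. kcoeff l' k * (cmod (d k))\<^sup>2)"
  shows moments_deriv_summable: "summable (\<lambda>k. kcoeff l k * (cmod (moments_deriv m d k))\<^sup>2)"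
    and moments_deriv_suminf_le: "(\<Sum>k. kcoeff l k * (cmod (moments_deriv m d k))\<^sup>2)
      \<le> pochhammer l (2 * m) * (\<Sum>k. kcoeff l' k * (cmod (d k))\<^sup>2)"
proof -
  let ?f = "\<lambda>k. kcoeff l k * (cmod (moments_deriv m d k))\<^sup>2"
  let ?g = "\<lambda>k. pochhammer l (2 * m) * (kcoeff l' k * (cmod (d k))\<^sup>2)"
  have le: "?f (k + m) \<le> ?g k" for k
  proof -
    have "?f (k + m) = (kcoeff l (k + m) * (fact (k + m) / fact k)\<^sup>2) * (cmod (d k))\<^sup>2"
      by (simp add: moments_deriv_def norm_mult norm_divide power_mult_distrib power_divide)
    also have "\<dots> \<le> (pochhammer l (2 * m) * kcoeff l' k) * (cmod (d k))\<^sup>2"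
      by (intro mult_right_mono kcoeff_derivative_bound l) simp
    finally show ?thesis
      by (simp add: mult.assoc)
  qed
  have sg: "summable ?g"
    by (intro summable_mult sm)
  have sf: "summable (\<lambda>k. ?f (k + m))"
    by (rule summable_comparison_test'[OF sg, where N = 0])
       (use le kcoeff_pos[OF l(1)] in \<open>simp add: less_imp_le\<close>)
  then show s: "summable ?f"
    using summable_iff_shift[of ?f m] by blast
  have "suminf ?f = (\<Sum>k. ?f (k + m)) + sum ?f {..<m}"
    by (rule suminf_split_initial_segment[OF s])
  also have "sum ?f {..<m} = 0"
    by (intro sum.neutral) (simp add: moments_deriv_def)
  also have "(\<Sum>k. ?f (k + m)) + 0 \<le> suminf ?g"
    using suminf_le[OF le sf sg] by simp
  also have "suminf ?g = pochhammer l (2 * m) * (\<Sum>k. kcoeff l' k * (cmod (d k))\<^sup>2)"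
    by (rule suminf_mult[OF sm])
  finally show "suminf ?f \<le> pochhammer l (2 * m) * (\<Sum>k. kcoeff l' k * (cmod (d k))\<^sup>2)" .
qed

lemma deriv_iterate_kernel:
  assumes "z \<in> \<D>" "w \<in> \<D>"
  shows "(deriv ^^ m) (\<lambda>v. (1 - z * v) powr (- of_real l)) w
    = of_real (pochhammer l m) * z ^ m * (1 - z * w) powr (- of_real (l + real m))"
  using assms(2)
proof (induction m arbitrary: w)
  case (Suc m)
  have "cmod z * cmod w < 1 * 1"
    using assms Suc.prems by (intro mult_strict_mono) auto
  then have "cmod (z * w) < 1"
    by (simp add: norm_mult)
  then have re: "Re (1 - z * w) > 0"
    using complex_Re_le_cmod[of "z * w"] by simp
  then have nonpos: "1 - z * w \<notin> \<real>\<^sub>\<le>\<^sub>0"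
    using complex_nonpos_Reals_iff by auto
  let ?F = "\<lambda>v. of_real (pochhammer l m) * z ^ m * (1 - z * v) powr (- of_real (l + real m))"
  have "eventually (\<lambda>v. v \<in> \<D>) (nhds w)"
    using Suc.prems by (intro eventually_nhds_in_open) auto
  then have "eventually (\<lambda>v. (deriv ^^ m) (\<lambda>v. (1 - z * v) powr (- of_real l)) v = ?F v) (nhds w)"
    by eventually_elim (rule Suc.IH)
  then have "(deriv ^^ Suc m) (\<lambda>v. (1 - z * v) powr (- of_real l)) w = deriv ?F w"
    by (simp add: deriv_cong_ev)
  also have "\<dots> = of_real (pochhammer l m) * z ^ m *
      ((- of_real (l + real m)) * (1 - z * w) powr (- of_real (l + real m) - 1) * (- z))"
    using nonpos by (intro DERIV_imp_deriv) (auto intro!: derivative_eq_intros)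
  also have "- complex_of_real (l + real m) - 1 = - of_real (l + real (Suc m))"
    by simp
  finally show ?case
    by (simp add: pochhammer_Suc algebra_simps)
qed simp

text \<open>
  The \<open>m\<close>-th derivative of the kernel is \<open>(l)\<^sub>m z\<^sup>m\<close> times the kernel of weight \<open>l + m\<close>, whose
  expansion is compared with the one on the right.
\<close>

lemma atom_deriv_eq_from_moments:
  assumes w: "w \<in> \<D>" and l: "0 < l"
  shows "atom_deriv l m w = from_moments l (moments_deriv m (\<lambda>k. w ^ k))"
proof
  fix z
  show "atom_deriv l m w z = from_moments l (moments_deriv m (\<lambda>k. w ^ k)) z"
  proof (cases "z \<in> \<D>")
    case True
    let ?t = "\<lambda>k. of_real (kcoeff l k) * moments_deriv m (\<lambda>k. w ^ k) k * z ^ k"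
    have "cmod z * cmod w < 1 * 1"
      using assms True by (intro mult_strict_mono) auto
    then have "(\<lambda>k. of_real (pochhammer l m) * z ^ m * (of_real (kcoeff (l + real m) k) * (z * w) ^ k))
        sums (of_real (pochhammer l m) * z ^ m * (1 - z * w) powr (- of_real (l + real m)))"
      by (intro sums_mult kcoeff_sums) (simp add: norm_mult)
    moreover have "of_real (pochhammer l m) * z ^ m * (of_real (kcoeff (l + real m) k) * (z * w) ^ k) = ?t (k + m)" for k
    proof -
      have "pochhammer l m * kcoeff (l + real m) k = kcoeff l (k + m) * (fact (k + m) / fact k)"
        using pochhammer_product'[of l m k] by (simp add: kcoeff_def add.commute)
      then have "complex_of_real (pochhammer l m) * of_real (kcoeff (l + real m) k)
          = of_real (kcoeff l (k + m)) * of_real (fact (k + m) / fact k)"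
        by (simp only: of_real_mult[symmetric])
      then show ?thesis
        by (simp add: moments_deriv_def power_mult_distrib power_add algebra_simps)
    qed
    ultimately have "(\<lambda>k. ?t (k + m)) sums (atom_deriv l m w z)"
      using True w by (simp add: atom_deriv_def on_domain_def deriv_iterate_kernel)
    moreover have "(\<Sum>k<m. ?t k) = 0"
      by (intro sum.neutral) (simp add: moments_deriv_def)
    ultimately have "?t sums atom_deriv l m w z"
      using sums_iff_shift'[of ?t m "atom_deriv l m w z"] by simp
    then show ?thesis
      using True by (simp add: from_moments_def on_domain_def sums_iff)
  qed (simp add: atom_deriv_def from_moments_def on_domain_def)
qed

context weighted_space
begin

lemma
  assumes w: "w \<in> \<D>"
  shows atom_deriv_mem: "atom_deriv l m w \<in> carrier H"
    and moment_atom_deriv: "moment H (atom_deriv l m w) k = moments_deriv m (\<lambda>k. w ^ k) k"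
proof -
  have "summable (\<lambda>k. kcoeff l k * (cmod (moments_deriv m (\<lambda>k. w ^ k) k))\<^sup>2)"
  proof (cases "m = 0")
    case False
    then show ?thesis
      using w by (intro moments_deriv_summable[OF pos _ order_refl] kcoeff_geometric_summable) auto
  qed (use w kcoeff_geometric_summable in simp)
  then show "atom_deriv l m w \<in> carrier H"
      "moment H (atom_deriv l m w) k = moments_deriv m (\<lambda>k. w ^ k) k"
    by (simp_all add: atom_deriv_eq_from_moments[OF w pos] from_moments_mem moment_from_moments)
qed

lemma moment_atom: "w \<in> \<D> \<Longrightarrow> moment H (atom_deriv l 0 w) k = w ^ k"
  by (simp add: moment_atom_deriv)

lemma mult_coordinate_moments:
  assumes f: "f \<in> carrier H"
  shows "mult_coordinate f \<in> carrier H"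
    and "moment H (mult_coordinate f) k
      = (case k of 0 \<Rightarrow> 0 | Suc j \<Rightarrow> of_real (kcoeff l j / kcoeff l (Suc j)) * moment H f j)"
proof -
  define d where "d k = (case k of 0 \<Rightarrow> 0 | Suc j \<Rightarrow> of_real (kcoeff l j / kcoeff l (Suc j)) * moment H f j)" for k
  define B where "B = max 1 (1 / l)"
  have ratio: "kcoeff l j / kcoeff l (Suc j) \<le> B" for j
  proof -
    have "kcoeff l j / kcoeff l (Suc j) = (real j + 1) / (l + real j)"
      using pos by (simp add: kcoeff_Suc add.commute)
    also have "\<dots> \<le> B"
    proof -
      have "real j + 1 \<le> B * real j + B * l"
      proof (intro add_mono)
        show "real j \<le> B * real j"
          by (simp add: B_def mult_le_cancel_right1)
        have "1 = (1 / l) * l"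
          using pos by simp
        also have "\<dots> \<le> B * l"
          using pos by (intro mult_right_mono) (auto simp: B_def)
        finally show "1 \<le> B * l" .
      qed
      then show ?thesis
        using pos by (simp add: divide_simps algebra_simps)
    qed
    finally show ?thesis .
  qed
  have "summable (\<lambda>k. kcoeff l (Suc k) * (cmod (d (Suc k)))\<^sup>2)"
  proof (rule summable_comparison_test'[where N = 0])
    show "summable (\<lambda>k. B * (kcoeff l k * (cmod (moment H f k))\<^sup>2))"
      by (intro summable_mult moments_square_summable f)
    fix k
    have "kcoeff l (Suc k) * (cmod (d (Suc k)))\<^sup>2
        = (kcoeff l k / kcoeff l (Suc k)) * (kcoeff l k * (cmod (moment H f k))\<^sup>2)"
      by (simp add: d_def norm_mult norm_divide power2_eq_square)
    also have "\<dots> \<le> B * (kcoeff l k * (cmod (moment H f k))\<^sup>2)"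
      using ratio[of k] kcoeff_pos[OF pos, of k] by (intro mult_right_mono) auto
    finally show "norm (kcoeff l (Suc k) * (cmod (d (Suc k)))\<^sup>2) \<le> B * (kcoeff l k * (cmod (moment H f k))\<^sup>2)"
      using kcoeff_pos[OF pos, of "Suc k"] by simp
  qed
  then have sd: "summable (\<lambda>k. kcoeff l k * (cmod (d k))\<^sup>2)"
    using summable_Suc_iff[of "\<lambda>k. kcoeff l k * (cmod (d k))\<^sup>2"] by blast
  have "mult_coordinate f = from_moments l d"
  proof
    fix z
    show "mult_coordinate f z = from_moments l d z"
    proof (cases "z \<in> \<D>")
      case True
      let ?t = "\<lambda>k. of_real (kcoeff l k) * d k * z ^ k"
      have "(\<lambda>k. z * (of_real (kcoeff l k) * moment H f k * z ^ k)) sums (z * f z)"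
        by (intro sums_mult taylor_moment f True)
      moreover have "z * (of_real (kcoeff l k) * moment H f k * z ^ k) = ?t (Suc k)" for k
        by (simp add: d_def)
      ultimately have "(\<lambda>k. ?t (Suc k)) sums (z * f z - ?t 0)"
        by (simp add: d_def)
      then have "?t sums (z * f z)"
        using sums_Suc_iff[of ?t "z * f z - ?t 0"] by simp
      then show ?thesis
        using True by (simp add: mult_coordinate_def from_moments_def on_domain_def sums_iff)
    next
      case False
      then show ?thesis
        using zero_outside[OF f False] by (simp add: mult_coordinate_def from_moments_def on_domain_def)
    qed
  qed
  then show "mult_coordinate f \<in> carrier H"
     "moment H (mult_coordinate f) k
      = (case k of 0 \<Rightarrow> 0 | Suc j \<Rightarrow> of_real (kcoeff l j / kcoeff l (Suc j)) * moment H f j)"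
    using from_moments_mem[OF sd] moment_from_moments[OF sd, of k] by (simp_all only: d_def[of k, symmetric])
qed

end

definition moment_shift :: "(complex \<Rightarrow> complex) hspace \<Rightarrow> ((complex \<Rightarrow> complex) \<Rightarrow> complex \<Rightarrow> complex) \<Rightarrow> bool"
  where "moment_shift H A \<longleftrightarrow>
    (\<forall>f\<in>carrier H. A f \<in> carrier H \<and> (\<forall>k. moment H (A f) k = moment H f (Suc k)))"

context weighted_space
begin

text \<open>
  By Parseval's identity, an operator that shifts moments is adjoint to multiplication by the
  coordinate: the factors \<open>kcoeff l j / kcoeff l (Suc j)\<close> picked up by the moments of \<open>z f(z)\<close> are
  those by which consecutive terms of the inner product differ.
\<close>

lemma adjoint_mult_coordinate:
  assumes A: "moment_shift H A" and f: "f \<in> carrier H"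
  shows "adjoint_op H mult_coordinate f = A f"
  unfolding adjoint_op_def
proof (rule the_equality)
  have Af: "A f \<in> carrier H" "\<And>k. moment H (A f) k = moment H f (Suc k)"
    using A f by (auto simp: moment_shift_def)
  have adj: "ip H (mult_coordinate g) f = ip H g (A f)" if g: "g \<in> carrier H" for g
  proof (rule sums_unique2)
    let ?t = "\<lambda>k. of_real (kcoeff l k) * moment H (mult_coordinate g) k * cnj (moment H f k)"
    have "?t sums ip H (mult_coordinate g) f"
      by (intro parseval mult_coordinate_moments g f)
    then have "(\<lambda>k. ?t (Suc k)) sums (ip H (mult_coordinate g) f - ?t 0)"
      using sums_Suc_iff[of ?t "ip H (mult_coordinate g) f - ?t 0"] by simp
    then show "(\<lambda>k. ?t (Suc k)) sums ip H (mult_coordinate g) f"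
      by (simp add: mult_coordinate_moments[OF g])
    have "?t (Suc k) = of_real (kcoeff l k) * moment H g k * cnj (moment H (A f) k)" for k
      by (simp add: mult_coordinate_moments[OF g] Af)
    then show "(\<lambda>k. ?t (Suc k)) sums ip H g (A f)"
      using parseval[OF g Af(1)] by simp
  qed
  then show "A f \<in> carrier H \<and> (\<forall>g\<in>carrier H. ip H (mult_coordinate g) f = ip H g (A f))"
    using Af by blast
  fix u
  assume u: "u \<in> carrier H \<and> (\<forall>g\<in>carrier H. ip H (mult_coordinate g) f = ip H g u)"
  have "moment H u k = moment H (A f) k" for k
    using u adj[of "monomial k"] Af(1) ip_commute[of u "monomial k"] ip_commute[of "A f" "monomial k"]
    by (simp add: moment_def)
  then show "u = A f"
    using u Af by (intro moment_inject) auto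
qed

end

section \<open>Bounded maps and their matrices\<close>

text \<open>
  The blocks of an operator on a direct sum act between different spaces, so that a notion with two
  spaces is needed besides \<open>bounded_op\<close>.
\<close>

definition bounded_lin ::
    "'a::complex_vector hspace \<Rightarrow> 'b::complex_vector hspace \<Rightarrow> ('a \<Rightarrow> 'b) \<Rightarrow> bool"
  where "bounded_lin H K A \<longleftrightarrow>
    (\<forall>x\<in>carrier H. A x \<in> carrier K) \<and>
    (\<forall>x\<in>carrier H. \<forall>y\<in>carrier H. A (x + y) = A x + A y) \<and>
    (\<forall>a. \<forall>x\<in>carrier H. A (a *\<^sub>C x) = a *\<^sub>C A x) \<and>
    (\<exists>C. \<forall>x\<in>carrier H. hnorm K (A x) \<le> C * hnorm H x)"

lemma bounded_op_iff_bounded_lin: "bounded_op H A \<longleftrightarrow> bounded_lin H H A"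
  by (simp add: bounded_op_def bounded_lin_def)

locale bounded_map = dom: hilbert H + cod: hilbert K
  for H :: "'a::complex_vector hspace" and K :: "'b::complex_vector hspace" +
  fixes A :: "'a \<Rightarrow> 'b"
  assumes bounded_lin: "bounded_lin H K A"
begin

lemma mem [simp]: "x \<in> carrier H \<Longrightarrow> A x \<in> carrier K"
  using bounded_lin unfolding bounded_lin_def by blast

lemma add: "x \<in> carrier H \<Longrightarrow> y \<in> carrier H \<Longrightarrow> A (x + y) = A x + A y"
  using bounded_lin unfolding bounded_lin_def by blast

lemma scale: "x \<in> carrier H \<Longrightarrow> A (c *\<^sub>C x) = c *\<^sub>C A x"
  using bounded_lin unfolding bounded_lin_def by blast

lemma zero: "A 0 = 0"
  using scale[OF dom.zero_mem, of 0] by simp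

lemma diff: "x \<in> carrier H \<Longrightarrow> y \<in> carrier H \<Longrightarrow> A (x - y) = A x - A y"
  using add[of "x - y" y] by simp

lemma sum: "(\<And>i. i \<in> I \<Longrightarrow> f i \<in> carrier H) \<Longrightarrow> A (\<Sum>i\<in>I. f i) = (\<Sum>i\<in>I. A (f i))"
  by (induction I rule: infinite_finite_induct) (simp_all add: zero add dom.sum_mem)

lemma bound: obtains C where "0 < C" "\<And>x. x \<in> carrier H \<Longrightarrow> hnorm K (A x) \<le> C * hnorm H x"
proof -
  obtain C where C: "\<And>x. x \<in> carrier H \<Longrightarrow> hnorm K (A x) \<le> C * hnorm H x"
    using bounded_lin unfolding bounded_lin_def by blast
  have "hnorm K (A x) \<le> max 1 C * hnorm H x" if "x \<in> carrier H" for x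
    using C[OF that] mult_right_mono[OF max.cobounded2[of C 1] dom.hnorm_nonneg[OF that]] by linarith
  then show ?thesis
    using that[of "max 1 C"] by simp
qed

end

locale weighted_map = dom: weighted_space l H + cod: weighted_space l' K
  for l H l' K +
  fixes A :: "(complex \<Rightarrow> complex) \<Rightarrow> complex \<Rightarrow> complex"
  assumes bdd: "bounded_lin H K A"
begin

sublocale bounded_map H K A
  by unfold_locales (rule bdd)

definition entry :: "nat \<Rightarrow> nat \<Rightarrow> complex"
  where "entry k m = moment K (A (basis_vec l m)) k"

lemma moment_sums:
  assumes f: "f \<in> carrier H"
  shows "(\<lambda>m. entry k m * moment H f m) sums moment K (A f) k"
proof -
  let ?p = "dom.partial (moment H f)"
  obtain C where C: "0 < C" "\<And>x. x \<in> carrier H \<Longrightarrow> hnorm K (A x) \<le> C * hnorm H x"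
    using bound by blast
  have "(\<lambda>N. hnorm K (A (?p N) - A f)) \<longlonglongrightarrow> 0"
  proof (rule Lim_null_comparison)
    show "(\<lambda>N. C * hnorm H (?p N - f)) \<longlonglongrightarrow> 0"
      using tendsto_mult_left[OF dom.partial_tendsto[OF f], of C] by simp
    show "\<forall>\<^sub>F N in sequentially. norm (hnorm K (A (?p N) - A f)) \<le> C * hnorm H (?p N - f)"
      using C(2)[of "?p _ - f"] f by (intro always_eventually) (simp add: diff cod.hnorm_nonneg)
  qed
  then have "(\<lambda>N. ip K (A (?p N)) (monomial k)) \<longlonglongrightarrow> ip K (A f) (monomial k)"
    using f by (intro cod.tendsto_ip_left) simp_all
  moreover have "ip K (A (?p N)) (monomial k) = (\<Sum>m<N. entry k m * moment H f m)" for N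
    by (simp add: dom.partial_def sum scale cod.ip_sum_left cod.ip_scale_left entry_def moment_def[of K] mult.commute)
  ultimately show ?thesis
    by (simp add: sums_def moment_def[of K])
qed

text \<open>
  The square on the left is one term of the squared norm of the image of a basis vector.
\<close>

lemma entry_bound:
  obtains C where "0 < C" "\<And>k m. kcoeff l' k * (cmod (entry k m))\<^sup>2 \<le> C * kcoeff l m"
proof -
  obtain C where C: "0 < C" "\<And>x. x \<in> carrier H \<Longrightarrow> hnorm K (A x) \<le> C * hnorm H x"
    using bound by blast
  have "kcoeff l' k * (cmod (entry k m))\<^sup>2 \<le> C\<^sup>2 * kcoeff l m" for k m
  proof -
    let ?t = "\<lambda>k. kcoeff l' k * (cmod (entry k m))\<^sup>2"
    have s: "?t sums (hnorm K (A (basis_vec l m)))\<^sup>2"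
      unfolding entry_def by (intro cod.hnorm_sums) simp
    have "sum ?t {k} \<le> suminf ?t"
      using s kcoeff_pos[OF cod.pos] by (intro sum_le_suminf) (auto simp: sums_iff less_imp_le)
    also have "\<dots> = (hnorm K (A (basis_vec l m)))\<^sup>2"
      using s by (simp add: sums_iff)
    also have "\<dots> \<le> (C * hnorm H (basis_vec l m))\<^sup>2"
      using C(2)[of "basis_vec l m"] cod.hnorm_nonneg[of "A (basis_vec l m)"] by (intro power_mono) auto
    also have "\<dots> = C\<^sup>2 * kcoeff l m"
      by (simp add: power_mult_distrib dom.hnorm_basis)
    finally show ?thesis
      by simp
  qed
  then show ?thesis
    using that[of "C\<^sup>2"] C(1) by simp
qed

text \<open>
  Along the curve of atoms, each moment of the image is a power series in \<open>w\<close> whose coefficients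
  form a row of the matrix.
\<close>

lemma entry_determined_by_atoms:
  assumes "\<And>w. w \<in> \<D> \<Longrightarrow> (\<lambda>m. c m * w ^ m) sums moment K (A (atom_deriv l 0 w)) k"
  shows "entry k m = c m"
proof (rule powser_coeff_unique)
  fix w assume w: "w \<in> \<D>"
  show "(\<lambda>m. c m * w ^ m) sums moment K (A (atom_deriv l 0 w)) k"
    by (rule assms[OF w])
  show "(\<lambda>m. entry k m * w ^ m) sums moment K (A (atom_deriv l 0 w)) k"
    using moment_sums[OF dom.atom_deriv_mem[OF w, of 0], of k] w by (simp add: dom.moment_atom)
qed

lemma zero_if_entries_zero:
  assumes "\<And>k m. entry k m = 0" "f \<in> carrier H"
  shows "A f = 0"
proof (rule cod.moment_inject)
  show "moment K (A f) k = moment K 0 k" for k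
    using moment_sums[OF assms(2), of k] assms(1) by (simp add: sums_iff cod.moment_zero)
qed (use assms in simp_all)

lemma zero_on_atoms:
  assumes "\<And>w. w \<in> \<D> \<Longrightarrow> A (atom_deriv l 0 w) = 0" "f \<in> carrier H"
  shows "A f = 0"
  using assms by (intro zero_if_entries_zero entry_determined_by_atoms) (simp_all add: cod.moment_zero)

lemma moment_if_entry_single:
  assumes "\<And>m. entry k m = (if m = j then c else 0)" "f \<in> carrier H"
  shows "moment K (A f) k = c * moment H f j"
proof (rule sums_unique2)
  show "(\<lambda>m. entry k m * moment H f m) sums moment K (A f) k"
    by (rule moment_sums[OF assms(2)])
  have "(\<lambda>m. entry k m * moment H f m) = (\<lambda>m. if m = j then c * moment H f j else 0)"
    by (auto simp: assms)
  then show "(\<lambda>m. entry k m * moment H f m) sums (c * moment H f j)"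
    using sums_single[of j "\<lambda>_. c * moment H f j"] by simp
qed

lemma moment_determined_by_atoms:
  assumes "\<And>w. w \<in> \<D> \<Longrightarrow> moment K (A (atom_deriv l 0 w)) k = c * w ^ j" "f \<in> carrier H"
  shows "moment K (A f) k = c * moment H f j"
proof (rule moment_if_entry_single[OF _ assms(2)], rule entry_determined_by_atoms)
  fix w assume w: "w \<in> \<D>"
  show "(\<lambda>m. (if m = j then c else 0) * w ^ m) sums moment K (A (atom_deriv l 0 w)) k"
    using sums_single[of j "\<lambda>m. c * w ^ m"]
    by (simp add: assms(1)[OF w] if_distrib[of "\<lambda>x. x * _"] cong: if_cong)
qed

lemma entry_recursion:
  assumes T: "moment_shift H T"
    and rel: "\<And>f k. f \<in> carrier H \<Longrightarrow> moment K (A f) (Suc k) = moment K (A (T f)) k + c * moment H f k"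
  shows "entry (Suc k) m = (case m of 0 \<Rightarrow> 0 | Suc j \<Rightarrow> entry k j) + (if k = m then c else 0)"
proof -
  have mT: "T (basis_vec l m) \<in> carrier H" "\<And>k. moment H (T (basis_vec l m)) k = (if Suc k = m then 1 else 0)"
    using T by (auto simp: moment_shift_def dom.moment_basis)
  have "T (basis_vec l m) = (case m of 0 \<Rightarrow> 0 | Suc j \<Rightarrow> basis_vec l j)"
    using mT by (intro dom.moment_inject) (auto simp: dom.moment_basis dom.moment_zero split: nat.splits)
  then show ?thesis
    using rel[of "basis_vec l m" k]
    by (cases m) (auto simp: entry_def dom.moment_basis zero cod.moment_zero)
qed

text \<open>
  The shift takes each basis vector to its predecessor and the first one to \<open>0\<close>. Applied to basis
  vectors, the relation thus says that an entry equals its upper left neighbour, and that the first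
  column vanishes below the diagonal.
\<close>

lemma intertwiner_entry:
  assumes T: "moment_shift H T"
    and rel: "\<And>f k. f \<in> carrier H \<Longrightarrow> moment K (A f) (Suc k) = moment K (A (T f)) k"
  shows "entry k m = (if k \<le> m then entry 0 (m - k) else 0)"
proof (induction k arbitrary: m)
  case (Suc k)
  then show ?case
    using entry_recursion[OF T, of 0 k m] rel by (cases m) auto
qed simp

text \<open>
  An entry of such a matrix is repeated down its whole diagonal, whereas \<open>entry_bound\<close> makes the
  entries tend to \<open>0\<close> along each diagonal when the target has the larger weight.
\<close>

lemma intertwiner_zero:
  assumes T: "moment_shift H T"
    and rel: "\<And>f k. f \<in> carrier H \<Longrightarrow> moment K (A f) (Suc k) = moment K (A (T f)) k"
    and less: "l < l'" and f: "f \<in> carrier H"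
  shows "A f = 0"
proof (rule zero_if_entries_zero[OF _ f])
  have "entry 0 s = 0" for s
  proof (rule ccontr)
    assume ne: "entry 0 s \<noteq> 0"
    obtain C where C: "0 < C" "\<And>k m. kcoeff l' k * (cmod (entry k m))\<^sup>2 \<le> C * kcoeff l m"
      using entry_bound by blast
    define B where "B = C * max 1 l ^ s / (cmod (entry 0 s))\<^sup>2"
    obtain k where k: "kcoeff l' k > B * kcoeff l k"
      using kcoeff_ratio_unbounded[OF dom.pos less] by blast
    have "kcoeff l' k * (cmod (entry 0 s))\<^sup>2 \<le> C * kcoeff l (k + s)"
      using C(2)[of k "k + s"] intertwiner_entry[OF T rel, of k "k + s"] by simp
    also have "\<dots> \<le> C * (max 1 l ^ s * kcoeff l k)"
      using C(1) by (intro mult_left_mono kcoeff_add_le dom.pos) auto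
    finally have "kcoeff l' k \<le> B * kcoeff l k"
      using ne by (simp add: B_def field_simps)
    with k show False
      by simp
  qed
  then show "entry k m = 0" for k m
    using intertwiner_entry[OF T rel, of k m] by simp
qed

text \<open>
  In terms of moments, the relation says that \<open>A\<close> solves \<open>T\<^sub>K A - A T\<^sub>H = c R\<close>, where \<open>R\<close> takes atoms to atoms. The map from
  atoms to \<open>c\<close> times their first derivatives is a formal solution, and any other one differs from it by an
  intertwiner, which has nothing below the diagonal. Hence the entries next to the diagonal are
  forced to be \<open>c (m + 1)\<close>, and this growth is compatible with boundedness only if the weights differ
  by at least \<open>2\<close>.
\<close>

lemma inner_derivation_bound:
  assumes T: "moment_shift H T"
    and rel: "\<And>f k. f \<in> carrier H \<Longrightarrow> moment K (A f) (Suc k) = moment K (A (T f)) k + c * moment H f k"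
    and c: "c \<noteq> 0"
  shows "l' + 2 \<le> l"
proof (rule ccontr)
  assume "\<not> l' + 2 \<le> l"
  then have less: "l < l' + 2"
    by simp
  have entry: "entry (Suc m) m = c * of_nat (Suc m)" for m
  proof (induction m)
    case (Suc m)
    then show ?case
      using entry_recursion[OF T rel, of "Suc m" "Suc m"] by (simp add: algebra_simps)
  qed (use entry_recursion[OF T rel, of 0 0] in simp)
  obtain C where C: "0 < C" "\<And>k m. kcoeff l' k * (cmod (entry k m))\<^sup>2 \<le> C * kcoeff l m"
    using entry_bound by blast
  define B where "B = C / ((cmod c)\<^sup>2 * l')"
  obtain m where m: "kcoeff (l' + 2) m > B * kcoeff l m"
    using kcoeff_ratio_unbounded[OF dom.pos less] by blast
  have "(cmod c)\<^sup>2 * (l' * kcoeff (l' + 2) m) \<le> (cmod c)\<^sup>2 * ((real (Suc m))\<^sup>2 * kcoeff l' (Suc m))"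
    by (intro mult_left_mono kcoeff_derivative_lower_bound cod.pos) simp
  also have "\<dots> = kcoeff l' (Suc m) * (cmod (entry (Suc m) m))\<^sup>2"
    unfolding entry norm_mult norm_of_nat by (simp only: power_mult_distrib mult_ac)
  also have "\<dots> \<le> C * kcoeff l m"
    by (rule C(2))
  finally have "kcoeff (l' + 2) m \<le> B * kcoeff l m"
    using c cod.pos by (simp add: B_def field_simps)
  with m show False
    by simp
qed

end

text \<open>
  Upper triangular matrices that are constant along diagonals multiply like formal power series,
  and these form a domain, in which \<open>0\<close> and \<open>1\<close> are the only idempotents.
\<close>

lemma (in weighted_space) commuting_idempotent:
  assumes A: "bounded_lin H H A" and T: "moment_shift H T"
    and comm: "\<And>f. f \<in> carrier H \<Longrightarrow> A (T f) = T (A f)"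
    and idem: "\<And>f. f \<in> carrier H \<Longrightarrow> A (A f) = A f"
  shows "(\<forall>f\<in>carrier H. A f = 0) \<or> (\<forall>f\<in>carrier H. A f = f)"
proof -
  interpret A: weighted_map l H l H A
    by unfold_locales (rule A)
  have rel: "moment H (A f) (Suc k) = moment H (A (T f)) k" if "f \<in> carrier H" for f k
    using T that by (simp add: moment_shift_def comm)
  have entry: "A.entry k m = (if k \<le> m then A.entry 0 (m - k) else 0)" for k m
    by (rule A.intertwiner_entry[OF T rel])
  define F where "F = Abs_fps (A.entry 0)"
  have "F * F = F"
  proof (rule fps_ext)
    fix s
    have "(\<lambda>m. A.entry 0 m * moment H (A (basis_vec l s)) m) sums moment H (A (A (basis_vec l s))) 0"
      by (rule A.moment_sums) simp
    then have "(\<lambda>m. A.entry 0 m * A.entry m s) sums A.entry 0 s"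
      by (simp add: idem A.entry_def)
    moreover have "(\<lambda>m. A.entry 0 m * A.entry m s) sums (\<Sum>m\<in>{0..s}. A.entry 0 m * A.entry m s)"
      by (rule sums_finite) (auto simp: entry[of _ s])
    ultimately have "(\<Sum>m\<in>{0..s}. A.entry 0 m * A.entry m s) = A.entry 0 s"
      by (rule sums_unique2[symmetric])
    moreover have "(\<Sum>m\<in>{0..s}. A.entry 0 m * A.entry m s) = (\<Sum>m\<in>{0..s}. A.entry 0 m * A.entry 0 (s - m))"
      by (intro sum.cong) (auto simp: entry[of _ s])
    ultimately show "fps_nth (F * F) s = fps_nth F s"
      by (simp add: F_def fps_mult_nth)
  qed
  then have "F * (F - 1) = 0"
    by (simp add: algebra_simps)
  then have "F = 0 \<or> F = 1"
    by simp
  then show ?thesis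
  proof
    assume "F = 0"
    then have "A.entry 0 s = 0" for s
      by (metis F_def fps_nth_Abs_fps fps_zero_nth)
    then show ?thesis
      using A.zero_if_entries_zero entry by (metis (no_types, lifting))
  next
    assume "F = 1"
    then have "A.entry 0 s = (if s = 0 then 1 else 0)" for s
      by (metis F_def fps_nth_Abs_fps fps_one_nth)
    then have e: "A.entry k m = (if m = k then 1 else 0)" for k m
      using entry[of k m] by auto
    have "A f = f" if f: "f \<in> carrier H" for f
      using A.moment_if_entry_single[OF e f] f by (intro moment_inject) auto
    then show ?thesis
      by blast
  qed
qed

lemma bounded_lin_moments_deriv:
  assumes "weighted_space l H" "weighted_space l' K" "1 \<le> m" "l' + 2 * real m \<le> l"
  shows "bounded_lin H K (\<lambda>f. from_moments l' (moments_deriv m (moment H f)))"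
proof -
  interpret H: weighted_space l H by fact
  interpret K: weighted_space l' K by fact
  let ?D = "\<lambda>f. from_moments l' (moments_deriv m (moment H f))"
  have sm: "summable (\<lambda>k. kcoeff l' k * (cmod (moments_deriv m (moment H f) k))\<^sup>2)" if "f \<in> carrier H" for f
    by (intro moments_deriv_summable[OF K.pos assms(3,4)] H.moments_square_summable that)
  have mem: "?D f \<in> carrier K" and mom: "moment K (?D f) k = moments_deriv m (moment H f) k"
    if "f \<in> carrier H" for f k
    using K.from_moments_mem[OF sm[OF that]] K.moment_from_moments[OF sm[OF that]] by auto
  have bound: "hnorm K (?D f) \<le> sqrt (pochhammer l' (2 * m)) * hnorm H f" if f: "f \<in> carrier H" for f
  proof (rule power2_le_imp_le)
    have "(hnorm K (?D f))\<^sup>2 = (\<Sum>k. kcoeff l' k * (cmod (moments_deriv m (moment H f) k))\<^sup>2)"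
      using K.hnorm_sums[OF mem[OF f]] by (simp add: mom[OF f] sums_iff)
    also have "\<dots> \<le> pochhammer l' (2 * m) * (\<Sum>k. kcoeff l k * (cmod (moment H f k))\<^sup>2)"
      by (intro moments_deriv_suminf_le[OF K.pos assms(3,4)] H.moments_square_summable f)
    also have "(\<Sum>k. kcoeff l k * (cmod (moment H f k))\<^sup>2) = (hnorm H f)\<^sup>2"
      using H.hnorm_sums[OF f] by (simp add: sums_iff)
    finally show "(hnorm K (?D f))\<^sup>2 \<le> (sqrt (pochhammer l' (2 * m)) * hnorm H f)\<^sup>2"
      using K.pos by (simp add: power_mult_distrib pochhammer_nonneg)
    show "0 \<le> sqrt (pochhammer l' (2 * m)) * hnorm H f"
      using K.pos f by (simp add: pochhammer_nonneg H.hnorm_nonneg)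
  qed
  show ?thesis
    unfolding bounded_lin_def
  proof (intro conjI ballI allI)
    fix f g assume fg: "f \<in> carrier H" "g \<in> carrier H"
    show "?D (f + g) = ?D f + ?D g"
      using fg mem[of "f + g"]
      by (intro K.moment_inject)
         (auto simp: mem mom K.moment_add moments_deriv_def H.moment_add algebra_simps)
  next
    fix c f assume f: "f \<in> carrier H"
    show "?D (c *\<^sub>C f) = c *\<^sub>C ?D f"
      using f mem[of "c *\<^sub>C f"]
      by (intro K.moment_inject)
         (auto simp: mem mom K.moment_scale moments_deriv_def H.moment_scale algebra_simps)
  qed (use mem bound in auto)
qed

section \<open>Bounded operators on a Hilbert space and on direct sums\<close>

lemma sum_single:
  assumes "finite I" "i \<in> I" "\<And>k. k \<in> I \<Longrightarrow> k \<noteq> i \<Longrightarrow> g k = 0"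
  shows "sum g I = g i"
proof -
  have "sum g I = sum g {i}"
    using assms by (intro sum.mono_neutral_right) auto
  then show ?thesis
    by simp
qed

text \<open>
  Back substitution in a homogeneous triangular system.
\<close>

lemma downward_zero:
  fixes y :: "nat \<Rightarrow> 'a::zero"
  assumes "\<And>i. i < n \<Longrightarrow> (\<And>j. i < j \<Longrightarrow> j < n \<Longrightarrow> y j = 0) \<Longrightarrow> y i = 0" "i < n"
  shows "y i = 0"
  using assms(2)
proof (induction "n - i" arbitrary: i rule: less_induct)
  case less
  show ?case
  proof (rule assms(1)[OF less.prems])
    fix j assume "i < j" "j < n"
    then show "y j = 0"
      by (intro less.hyps) auto
  qed
qed

lemma bounded_map_intro: "hilbert H \<Longrightarrow> hilbert K \<Longrightarrow> bounded_lin H K A \<Longrightarrow> bounded_map H K A"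
  by (simp add: bounded_map_def bounded_map_axioms_def)

lemma bounded_lin_zero:
  assumes "hilbert H" "hilbert K"
  shows "bounded_lin H K (\<lambda>_. 0)"
  using assms by (auto simp: bounded_lin_def hilbert.zero_mem hilbert.hnorm_zero intro!: exI[of _ 0])

lemma (in bounded_map) bounded_lin_scaled: "bounded_lin H K (\<lambda>x. c *\<^sub>C A x)"
proof -
  obtain C where C: "\<And>x. x \<in> carrier H \<Longrightarrow> hnorm K (A x) \<le> C * hnorm H x"
    using bound by blast
  have b: "hnorm K (c *\<^sub>C A x) \<le> (cmod c * C) * hnorm H x" if "x \<in> carrier H" for x
    using mult_left_mono[OF C[OF that], of "cmod c"] that by (simp add: cod.hnorm_scale mult.assoc)
  show ?thesis
    unfolding bounded_lin_def
  proof (intro conjI ballI allI exI)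
    show "c *\<^sub>C A (a *\<^sub>C x) = a *\<^sub>C c *\<^sub>C A x" if "x \<in> carrier H" for a x
      using that by (simp add: scale scaleC_scaleC mult.commute)
  qed (use b in \<open>auto simp: add scaleC_add_right\<close>)
qed

context hilbert
begin

lemma bounded_op_zero: "bounded_op H (\<lambda>x. 0)"
  using bounded_lin_zero hilbert_axioms by (auto simp: bounded_op_iff_bounded_lin)

lemma bounded_op_id: "bounded_op H (\<lambda>x. x)"
  unfolding bounded_op_def by (auto intro!: exI[of _ 1])

lemma bounded_map_iff: "bounded_map H H A \<longleftrightarrow> bounded_op H A"
  by (auto simp: bounded_op_iff_bounded_lin bounded_map.bounded_lin intro: bounded_map_intro hilbert_axioms)

lemma bounded_op_add:
  assumes "bounded_op H A" "bounded_op H B"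
  shows "bounded_op H (\<lambda>x. A x + B x)"
proof -
  interpret A: bounded_map H H A
    using assms bounded_map_iff by blast
  interpret B: bounded_map H H B
    using assms bounded_map_iff by blast
  obtain C where C: "\<And>x. x \<in> carrier H \<Longrightarrow> hnorm H (A x) \<le> C * hnorm H x"
    using A.bound by blast
  obtain D where D: "\<And>x. x \<in> carrier H \<Longrightarrow> hnorm H (B x) \<le> D * hnorm H x"
    using B.bound by blast
  have "hnorm H (A x + B x) \<le> (C + D) * hnorm H x" if "x \<in> carrier H" for x
    using hnorm_triangle[of "A x" "B x"] C[OF that] D[OF that] that by (simp add: distrib_right)
  then show ?thesis
    unfolding bounded_op_def by (auto simp: A.add B.add A.scale B.scale scaleC_add_right)
qed

lemma bounded_op_compose:
  assumes "bounded_op H A" "bounded_op H B"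
  shows "bounded_op H (\<lambda>x. A (B x))"
proof -
  interpret A: bounded_map H H A
    using assms bounded_map_iff by blast
  interpret B: bounded_map H H B
    using assms bounded_map_iff by blast
  obtain C where C: "0 < C" "\<And>x. x \<in> carrier H \<Longrightarrow> hnorm H (A x) \<le> C * hnorm H x"
    using A.bound by blast
  obtain D where D: "\<And>x. x \<in> carrier H \<Longrightarrow> hnorm H (B x) \<le> D * hnorm H x"
    using B.bound by blast
  have "hnorm H (A (B x)) \<le> (C * D) * hnorm H x" if "x \<in> carrier H" for x
  proof -
    have "hnorm H (A (B x)) \<le> C * hnorm H (B x)"
      using that by (intro C B.mem)
    also have "\<dots> \<le> C * (D * hnorm H x)"
      using C(1) by (intro mult_left_mono D that) simp
    finally show ?thesis
      by (simp add: mult.assoc)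
  qed
  then show ?thesis
    unfolding bounded_op_def by (auto simp: A.add B.add A.scale B.scale)
qed

lemma bounded_op_scale: "bounded_op H A \<Longrightarrow> bounded_op H (\<lambda>x. c *\<^sub>C A x)"
  using bounded_map.bounded_lin_scaled bounded_map_iff bounded_op_iff_bounded_lin by metis

lemma bounded_op_diff:
  assumes "bounded_op H A" "bounded_op H B"
  shows "bounded_op H (\<lambda>x. A x - B x)"
  using bounded_op_add[OF assms(1) bounded_op_scale[OF assms(2), of "-1"]]
  by (simp add: complex_vs.scale_minus_left scaleC_one)

lemma bounded_op_funpow: "bounded_op H A \<Longrightarrow> bounded_op H (A ^^ k)"
proof (induction k)
  case (Suc k)
  then show ?case
    using bounded_op_compose[of A "A ^^ k"] by (simp add: comp_def)
qed (use bounded_op_id in \<open>simp add: id_def\<close>)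

lemma bounded_op_sum:
  fixes N :: nat
  assumes "\<And>k. bounded_op H (A k)"
  shows "bounded_op H (\<lambda>x. \<Sum>k<N. A k x)"
proof (induction N)
  case (Suc N)
  then show ?case
    using bounded_op_add assms by simp
qed (simp add: bounded_op_zero)

text \<open>
  The inverse of \<open>I - Q\<close> is the finite geometric series in the nilpotent operator \<open>Q\<close>.
\<close>

lemma neumann_inverse:
  assumes Q: "bounded_op H Q" and nil: "\<And>x. x \<in> carrier H \<Longrightarrow> (Q ^^ n) x = 0"
  obtains L where "bounded_op H L" "\<And>x. x \<in> carrier H \<Longrightarrow> L (x - Q x) = x"
    "\<And>x. x \<in> carrier H \<Longrightarrow> L x - Q (L x) = x"
proof -
  define L where "L x = (\<Sum>k<n. (Q ^^ k) x)" for x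
  interpret Q: bounded_map H H Q
    using Q bounded_map_iff by blast
  have pow: "bounded_map H H (Q ^^ k)" for k
    using bounded_op_funpow[OF Q] bounded_map_iff by blast
  have mem: "(Q ^^ k) x \<in> carrier H" if "x \<in> carrier H" for k x
    by (rule bounded_map.mem[OF pow that])
  have tele: "(\<Sum>k<n. (Q ^^ k) x - (Q ^^ Suc k) x) = x" if "x \<in> carrier H" for x
    using sum_lessThan_telescope'[of "\<lambda>k. (Q ^^ k) x" n] nil[OF that] by simp
  show ?thesis
  proof
    show "bounded_op H L"
      unfolding L_def by (rule bounded_op_sum[OF bounded_op_funpow[OF Q]])
    fix x assume x: "x \<in> carrier H"
    have "(Q ^^ k) (x - Q x) = (Q ^^ k) x - (Q ^^ Suc k) x" for k
      using bounded_map.diff[OF pow x Q.mem[OF x]] by (simp only: funpow_Suc_right comp_apply)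
    then show "L (x - Q x) = x"
      using tele[OF x] by (simp add: L_def)
    have "Q (L x) = (\<Sum>k<n. (Q ^^ Suc k) x)"
      unfolding L_def using mem[OF x] by (simp add: Q.sum)
    then show "L x - Q (L x) = x"
      using tele[OF x] by (simp add: L_def sum_subtractf)
  qed
qed

lemma strongly_reducible_similar:
  assumes sim: "similar_ops H A B" and A: "bounded_op H A" and red: "strongly_reducible H B"
  shows "strongly_reducible H A"
proof -
  obtain L M where LM: "bounded_op H L" "bounded_op H M"
    and inv: "\<And>x. x \<in> carrier H \<Longrightarrow> L (M x) = x" "\<And>x. x \<in> carrier H \<Longrightarrow> M (L x) = x"
    and B: "\<And>x. x \<in> carrier H \<Longrightarrow> L (A (M x)) = B x"
    using sim unfolding similar_ops_def by blast
  obtain P where P: "bounded_op H P" "\<And>x. x \<in> carrier H \<Longrightarrow> P (B x) = B (P x)"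
    "\<And>x. x \<in> carrier H \<Longrightarrow> P (P x) = P x"
    and ne: "\<exists>x\<in>carrier H. P x \<noteq> 0" "\<exists>x\<in>carrier H. P x \<noteq> x"
    using red unfolding strongly_irreducible_def by blast
  interpret L: bounded_map H H L
    using LM bounded_map_iff by blast
  interpret M: bounded_map H H M
    using LM bounded_map_iff by blast
  interpret P: bounded_map H H P
    using P bounded_map_iff by blast
  interpret A: bounded_map H H A
    using A bounded_map_iff by blast
  let ?P = "\<lambda>x. M (P (L x))"
  have MP: "L (?P (M x)) = P x" if "x \<in> carrier H" for x
    using that by (simp add: inv)
  have "bounded_op H ?P"
    by (intro bounded_op_compose[OF LM(2)] bounded_op_compose[OF P(1) LM(1)])
  moreover have "?P (A x) = A (?P x)" if x: "x \<in> carrier H" for x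
  proof -
    have "L (A x) = B (L x)"
      using B[of "L x"] x by (simp add: inv)
    moreover have "M (B y) = A (M y)" if "y \<in> carrier H" for y
      using B[OF that, symmetric] that by (simp add: inv)
    ultimately show ?thesis
      using x by (simp add: P)
  qed
  moreover have "?P (?P x) = ?P x" if "x \<in> carrier H" for x
    using that by (simp add: inv P)
  moreover have "\<exists>x\<in>carrier H. ?P x \<noteq> 0"
    using ne(1) MP M.mem L.zero by metis
  moreover have "\<exists>x\<in>carrier H. ?P x \<noteq> x"
    using ne(2) MP M.mem inv(1) by metis
  ultimately show ?thesis
    unfolding strongly_irreducible_def by blast
qed

end

definition incl :: "nat \<Rightarrow> 'a::complex_vector \<Rightarrow> nat \<Rightarrow> 'a"
  where "incl j x = (\<lambda>k. if k = j then x else 0)"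

lemma block_eq: "block A i j x = A (incl j x) i"
  by (simp add: block_def incl_def)

lemma incl_same [simp]: "incl j x j = x"
  by (simp add: incl_def)

lemma incl_other [simp]: "i \<noteq> j \<Longrightarrow> incl j x i = 0"
  by (simp add: incl_def)

lemma incl_add: "incl j (x + y) = incl j x + incl j y"
  by (simp add: incl_def fun_eq_iff)

lemma incl_scale: "incl j (c *\<^sub>C x) = c *\<^sub>C incl j x"
  by (simp add: incl_def fun_eq_iff)

locale hilbert_sum =
  fixes n :: nat and H :: "nat \<Rightarrow> 'a::complex_vector hspace"
  assumes summand: "i < n \<Longrightarrow> hilbert (H i)"
    and direct_sum: "hilbert (direct_sum n H)"
begin

abbreviation "S \<equiv> direct_sum n H"

sublocale total: hilbert S
  by (rule direct_sum)

lemma mem_iff: "x \<in> carrier S \<longleftrightarrow> (\<forall>i<n. x i \<in> carrier (H i)) \<and> (\<forall>i\<ge>n. x i = 0)"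
  by (simp add: direct_sum_def)

lemma eqI: "x \<in> carrier S \<Longrightarrow> y \<in> carrier S \<Longrightarrow> (\<And>i. i < n \<Longrightarrow> x i = y i) \<Longrightarrow> x = y"
  unfolding mem_iff by (metis ext not_le)

lemma component_mem: "x \<in> carrier S \<Longrightarrow> i < n \<Longrightarrow> x i \<in> carrier (H i)"
  by (simp add: mem_iff)

lemma hnorm_eq_L2: "x \<in> carrier S \<Longrightarrow> hnorm S x = L2_set (\<lambda>i. hnorm (H i) (x i)) {..<n}"
  unfolding L2_set_def hnorm_def[of S]
  by (auto simp: direct_sum_def hilbert.ip_self[OF summand] intro!: sum.cong simp del: of_real_power)

lemma component_le:
  assumes "x \<in> carrier S" "i < n"
  shows "hnorm (H i) (x i) \<le> hnorm S x"
  unfolding hnorm_eq_L2[OF assms(1)]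
  using assms(2) by (intro member_le_L2_set) auto

lemma hnorm_le_sum: "x \<in> carrier S \<Longrightarrow> hnorm S x \<le> (\<Sum>i<n. hnorm (H i) (x i))"
  unfolding hnorm_eq_L2 by (rule L2_set_le_sum) (simp add: hilbert.hnorm_nonneg[OF summand] component_mem)

lemma incl_mem: "j < n \<Longrightarrow> x \<in> carrier (H j) \<Longrightarrow> incl j x \<in> carrier S"
  using hilbert.zero_mem[OF summand] by (auto simp: mem_iff incl_def)

lemma hnorm_incl_le:
  assumes "j < n" "x \<in> carrier (H j)"
  shows "hnorm S (incl j x) \<le> hnorm (H j) x"
proof -
  have "(\<Sum>i<n. hnorm (H i) (incl j x i)) = hnorm (H j) (incl j x j)"
    using assms by (intro sum_single) (auto simp: hilbert.hnorm_zero[OF summand])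
  then show ?thesis
    using hnorm_le_sum[OF incl_mem[OF assms]] by simp
qed

lemma decompose: "x \<in> carrier S \<Longrightarrow> x = (\<Sum>j<n. incl j (x j))"
  by (auto simp: fun_eq_iff sum_fun_apply incl_def mem_iff)

lemma bounded_lin_block:
  assumes A: "bounded_op S A" and ij: "i < n" "j < n"
  shows "bounded_lin (H j) (H i) (block A i j)"
proof -
  interpret A: bounded_map S S A
    using A total.bounded_map_iff by blast
  obtain C where C: "0 < C" "\<And>x. x \<in> carrier S \<Longrightarrow> hnorm S (A x) \<le> C * hnorm S x"
    using A.bound by blast
  have "hnorm (H i) (A (incl j x) i) \<le> C * hnorm (H j) x" if x: "x \<in> carrier (H j)" for x
  proof -
    have "hnorm (H i) (A (incl j x) i) \<le> hnorm S (A (incl j x))"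
      by (intro component_le A.mem incl_mem x ij)
    also have "\<dots> \<le> C * hnorm S (incl j x)"
      by (intro C incl_mem x ij)
    also have "\<dots> \<le> C * hnorm (H j) x"
      using C(1) by (intro mult_left_mono hnorm_incl_le x ij) auto
    finally show ?thesis .
  qed
  then show ?thesis
    unfolding bounded_lin_def block_eq incl_add incl_scale
    using ij by (auto simp: A.add A.scale incl_mem component_mem)
qed

lemma bounded_map_block:
  assumes "bounded_op S A" "i < n" "j < n"
  shows "bounded_map (H j) (H i) (block A i j)"
  using assms by (intro bounded_map_intro summand bounded_lin_block)

lemma block_mem: "bounded_op S A \<Longrightarrow> i < n \<Longrightarrow> j < n \<Longrightarrow> x \<in> carrier (H j) \<Longrightarrow> block A i j x \<in> carrier (H i)"
  by (rule bounded_map.mem[OF bounded_map_block])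

lemma block_zero: "bounded_op S A \<Longrightarrow> i < n \<Longrightarrow> j < n \<Longrightarrow> block A i j 0 = 0"
  by (rule bounded_map.zero[OF bounded_map_block])

lemma apply_blocks:
  assumes A: "bounded_op S A" and x: "x \<in> carrier S"
  shows "A x i = (\<Sum>j<n. block A i j (x j))"
proof -
  interpret A: bounded_map S S A
    using A total.bounded_map_iff by blast
  have "A x = A (\<Sum>j<n. incl j (x j))"
    by (rule arg_cong[OF decompose[OF x]])
  also have "\<dots> = (\<Sum>j<n. A (incl j (x j)))"
    using x by (intro A.sum) (auto simp: incl_mem component_mem)
  finally show ?thesis
    by (simp add: sum_fun_apply block_eq)
qed

lemma block_compose:
  assumes "bounded_op S A" "bounded_op S B" "k < n" "f \<in> carrier (H k)"
  shows "A (B (incl k f)) i = (\<Sum>j<n. block A i j (block B j k f))"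
proof -
  interpret B: bounded_map S S B
    using assms total.bounded_map_iff by blast
  show ?thesis
    using apply_blocks[OF assms(1) B.mem[OF incl_mem[OF assms(3,4)]], of i] by (simp add: block_eq)
qed

definition upper_triangular :: "((nat \<Rightarrow> 'a) \<Rightarrow> nat \<Rightarrow> 'a) \<Rightarrow> bool"
  where "upper_triangular A \<longleftrightarrow> (\<forall>i<n. \<forall>j<i. \<forall>f\<in>carrier (H j). block A i j f = 0)"

lemma upper_triangularD: "upper_triangular A \<Longrightarrow> j < i \<Longrightarrow> i < n \<Longrightarrow> f \<in> carrier (H j) \<Longrightarrow> block A i j f = 0"
  by (simp add: upper_triangular_def)

lemma triangular_sum:
  assumes A: "bounded_op S A" "upper_triangular A" and ij: "i < n" "j < n"
    and x: "\<And>k. k < n \<Longrightarrow> x k \<in> carrier (H k)" "\<And>k. j < k \<Longrightarrow> k < n \<Longrightarrow> x k = 0"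
  shows "(\<Sum>k<n. block A i k (x k)) = (\<Sum>k\<in>{i..j}. block A i k (x k))"
proof (rule sum.mono_neutral_right)
  show "\<forall>k\<in>{..<n} - {i..j}. block A i k (x k) = 0"
  proof
    fix k assume k: "k \<in> {..<n} - {i..j}"
    show "block A i k (x k) = 0"
    proof (cases "k < i")
      case True
      then show ?thesis
        using k ij by (intro upper_triangularD[OF A(2)] x) auto
    next
      case False
      then show ?thesis
        using k ij x(2) by (simp add: block_zero[OF A(1)])
    qed
  qed
qed (use ij in auto)

lemma block_compose_triangular:
  assumes A: "bounded_op S A" "upper_triangular A" and B: "bounded_op S B" "upper_triangular B"
    and ij: "i < n" "j < n" and f: "f \<in> carrier (H j)"
  shows "A (B (incl j f)) i = (\<Sum>k\<in>{i..j}. block A i k (block B k j f))"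
  unfolding block_compose[OF A(1) B(1) ij(2) f]
  using f ij by (intro triangular_sum[OF A] block_mem[OF B(1)] upper_triangularD[OF B(2)])

definition from_blocks :: "(nat \<Rightarrow> nat \<Rightarrow> 'a \<Rightarrow> 'a) \<Rightarrow> (nat \<Rightarrow> 'a) \<Rightarrow> nat \<Rightarrow> 'a"
  where "from_blocks B x = (\<lambda>i. if i < n then \<Sum>j<n. B i j (x j) else 0)"

lemma from_blocks_apply: "from_blocks B x i = (if i < n then \<Sum>j<n. B i j (x j) else 0)"
  by (simp add: from_blocks_def)

lemma bounded_op_from_blocks:
  assumes B: "\<And>i j. i < n \<Longrightarrow> j < n \<Longrightarrow> bounded_lin (H j) (H i) (B i j)"
  shows "bounded_op S (from_blocks B)"
proof -
  have map: "bounded_map (H j) (H i) (B i j)" if "i < n" "j < n" for i j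
    using that by (intro bounded_map_intro summand B)
  have mem: "B i j (x j) \<in> carrier (H i)" if "i < n" "j < n" "x \<in> carrier S" for i j x
    using bounded_map.mem[OF map] component_mem that by blast
  have S_mem: "from_blocks B x \<in> carrier S" if "x \<in> carrier S" for x
  proof -
    have "(\<Sum>j<n. B i j (x j)) \<in> carrier (H i)" if "i < n" for i
      using that mem \<open>x \<in> carrier S\<close> by (intro hilbert.sum_mem[OF summand]) auto
    then show ?thesis
      unfolding mem_iff by (simp add: from_blocks_def)
  qed
  have "\<forall>i j. \<exists>C. 0 < C \<and> (i < n \<longrightarrow> j < n \<longrightarrow> (\<forall>f\<in>carrier (H j). hnorm (H i) (B i j f) \<le> C * hnorm (H j) f))"
    using bounded_map.bound[OF map] by (metis zero_less_one)
  then obtain C where C: "\<And>i j. 0 < C i j"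
    "\<And>i j f. i < n \<Longrightarrow> j < n \<Longrightarrow> f \<in> carrier (H j) \<Longrightarrow> hnorm (H i) (B i j f) \<le> C i j * hnorm (H j) f"
    by metis
  have bound: "hnorm S (from_blocks B x) \<le> (\<Sum>i<n. \<Sum>j<n. C i j) * hnorm S x" if x: "x \<in> carrier S" for x
  proof -
    have "hnorm S (from_blocks B x) \<le> (\<Sum>i<n. hnorm (H i) (\<Sum>j<n. B i j (x j)))"
      using hnorm_le_sum[OF S_mem[OF x]] by (simp add: from_blocks_def)
    also have "\<dots> \<le> (\<Sum>i<n. \<Sum>j<n. C i j * hnorm S x)"
    proof (intro sum_mono)
      fix i assume i: "i \<in> {..<n}"
      have "hnorm (H i) (\<Sum>j<n. B i j (x j)) \<le> (\<Sum>j<n. hnorm (H i) (B i j (x j)))"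
        using i x by (intro hilbert.hnorm_sum[OF summand]) (auto intro: mem)
      also have "\<dots> \<le> (\<Sum>j<n. C i j * hnorm S x)"
      proof (intro sum_mono)
        fix j assume j: "j \<in> {..<n}"
        have "hnorm (H i) (B i j (x j)) \<le> C i j * hnorm (H j) (x j)"
          using i j x by (intro C) (auto simp: component_mem)
        also have "\<dots> \<le> C i j * hnorm S x"
          using j x C(1)[of i j] by (intro mult_left_mono component_le) auto
        finally show "hnorm (H i) (B i j (x j)) \<le> C i j * hnorm S x" .
      qed
      finally show "hnorm (H i) (\<Sum>j<n. B i j (x j)) \<le> (\<Sum>j<n. C i j * hnorm S x)" .
    qed
    finally show ?thesis
      by (simp add: sum_distrib_right)
  qed
  show ?thesis
    unfolding bounded_op_def
  proof (intro conjI ballI allI)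
    fix x y assume "x \<in> carrier S" "y \<in> carrier S"
    then show "from_blocks B (x + y) = from_blocks B x + from_blocks B y"
      by (auto simp: from_blocks_def fun_eq_iff sum.distrib[symmetric] bounded_map.add[OF map] component_mem
          intro!: sum.cong)
  next
    fix c x assume "x \<in> carrier S"
    then show "from_blocks B (c *\<^sub>C x) = c *\<^sub>C from_blocks B x"
      by (auto simp: from_blocks_def fun_eq_iff complex_vs.scale_sum_right bounded_map.scale[OF map] component_mem
          intro!: sum.cong)
  qed (use S_mem bound in auto)
qed

lemma bounded_op_direct_sum_op:
  assumes "\<And>i. i < n \<Longrightarrow> bounded_lin (H i) (H i) (A i)"
  shows "bounded_op S (direct_sum_op n A)"
proof -
  have "from_blocks (\<lambda>i j. if i = j then A i else (\<lambda>_. 0)) = direct_sum_op n A"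
  proof (intro ext)
    fix x i
    show "from_blocks (\<lambda>i j. if i = j then A i else (\<lambda>_. 0)) x i = direct_sum_op n A x i"
      by (auto simp: from_blocks_def direct_sum_op_def intro!: sum_single[where i = i, THEN trans])
  qed
  moreover have "bounded_lin (H j) (H i) (if i = j then A i else (\<lambda>_. 0))" if "i < n" "j < n" for i j
    using that by (cases "i = j") (simp_all add: assms bounded_lin_zero summand)
  ultimately show ?thesis
    using bounded_op_from_blocks[of "\<lambda>i j. if i = j then A i else (\<lambda>_. 0)"] by simp
qed

lemma direct_sum_op_incl:
  "(\<And>i. i < n \<Longrightarrow> A i 0 = 0) \<Longrightarrow> j < n \<Longrightarrow> direct_sum_op n A (incl j f) = incl j (A j f)"
  by (auto simp: direct_sum_op_def incl_def fun_eq_iff)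

lemma strongly_reducible_direct_sum_op:
  assumes A: "\<And>i. i < n \<Longrightarrow> bounded_lin (H i) (H i) (A i)"
    and n: "2 \<le> n" and ne: "\<And>i. i < n \<Longrightarrow> \<exists>x\<in>carrier (H i). x \<noteq> 0"
  shows "strongly_reducible S (direct_sum_op n A)"
proof -
  let ?P = "direct_sum_op n (\<lambda>i. if i = 0 then (\<lambda>x. x) else (\<lambda>_. 0)) :: (nat \<Rightarrow> 'a) \<Rightarrow> nat \<Rightarrow> 'a"
  have A0: "A i 0 = 0" if "i < n" for i
    by (rule bounded_map.zero[OF bounded_map_intro[OF summand[OF that] summand[OF that] A[OF that]]])
  have "bounded_op S ?P"
    by (rule bounded_op_direct_sum_op)
       (use hilbert.bounded_op_id[OF summand] hilbert.bounded_op_zero[OF summand]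
        in \<open>auto simp: bounded_op_iff_bounded_lin\<close>)
  moreover have "?P (direct_sum_op n A x) = direct_sum_op n A (?P x)" "?P (?P x) = ?P x" for x
    by (auto simp: direct_sum_op_def fun_eq_iff A0)
  moreover have "\<exists>x\<in>carrier S. ?P x \<noteq> 0"
  proof -
    obtain f where "f \<in> carrier (H 0)" "f \<noteq> 0"
      using ne[of 0] n by auto
    then have "?P (incl 0 f) 0 \<noteq> 0" "incl 0 f \<in> carrier S"
      using n by (auto simp: direct_sum_op_def incl_mem)
    then show ?thesis
      by (metis zero_fun_apply)
  qed
  moreover have "\<exists>x\<in>carrier S. ?P x \<noteq> x"
  proof -
    obtain f where "f \<in> carrier (H 1)" "f \<noteq> 0"
      using ne[of 1] n by auto
    then have "?P (incl 1 f) 1 \<noteq> incl 1 f 1" "incl 1 f \<in> carrier S"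
      using n by (auto simp: direct_sum_op_def incl_mem)
    then show ?thesis
      by metis
  qed
  ultimately show ?thesis
    unfolding strongly_irreducible_def by blast
qed

end

section \<open>The triangular form of a quasi-homogeneous operator\<close>

locale quasi_homogeneous =
  fixes n :: nat and lam0 \<Lambda> :: real and \<mu> :: "nat \<Rightarrow> nat \<Rightarrow> complex"
    and H :: "nat \<Rightarrow> (complex \<Rightarrow> complex) hspace"
    and T :: "(nat \<Rightarrow> complex \<Rightarrow> complex) \<Rightarrow> nat \<Rightarrow> complex \<Rightarrow> complex"
  assumes curve: "quasi_homogeneous_curve n lam0 \<Lambda> \<mu>"
    and spaces: "\<forall>i<n. is_A_space (qh_weight lam0 \<Lambda> i) (H i)"
    and T_op: "quasi_homogeneous_op n lam0 \<Lambda> \<mu> H T"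
begin

abbreviation lam :: "nat \<Rightarrow> real" where "lam \<equiv> qh_weight lam0 \<Lambda>"
abbreviation atom :: "nat \<Rightarrow> complex \<Rightarrow> complex \<Rightarrow> complex" where "atom j \<equiv> atom_deriv (lam j) 0"
abbreviation frame where "frame \<equiv> qh_frame lam0 \<Lambda> \<mu>"

lemma n_ge: "2 \<le> n"
  and lam_pos: "0 < lam i"
  and valency_pos: "0 < \<Lambda>"
  and \<mu>_diag: "i < n \<Longrightarrow> \<mu> i i = 1"
  and \<mu>_superdiag: "Suc i < n \<Longrightarrow> \<mu> i (Suc i) \<noteq> 0"
  using curve by (auto simp: quasi_homogeneous_curve_def qh_weight_def intro: add_pos_nonneg)

lemma lam_diff: "lam (i + m) = lam i + real m * \<Lambda>"
  by (simp add: qh_weight_def algebra_simps)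

lemma weighted: "i < n \<Longrightarrow> weighted_space (lam i) (H i)"
  using spaces lam_pos by unfold_locales auto

sublocale hilbert_sum n H
proof unfold_locales
  show "hilbert_space (H i)" if "i < n" for i
    using spaces that by (simp add: is_A_space_def)
  show "hilbert_space (direct_sum n H)"
    using T_op by (simp add: quasi_homogeneous_op_def cowen_douglas_def)
qed

lemma T_bounded: "bounded_op S T"
  and T_frame: "w \<in> \<D> \<Longrightarrow> j < n \<Longrightarrow> T (frame j w) = w *\<^sub>C frame j w"
  using T_op by (simp_all add: quasi_homogeneous_op_def)

lemma weighted_map_block:
  assumes "bounded_op S A" "i < n" "j < n"
  shows "weighted_map (lam j) (H j) (lam i) (H i) (block A i j)"
  using bounded_lin_block[OF assms] weighted assms
  by (simp add: weighted_map_def weighted_map_axioms_def)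

lemma atom_deriv_mem: "i < n \<Longrightarrow> w \<in> \<D> \<Longrightarrow> atom_deriv (lam i) m w \<in> carrier (H i)"
  by (rule weighted_space.atom_deriv_mem[OF weighted])

lemma atom_nonzero: "i < n \<Longrightarrow> atom i 0 \<noteq> 0"
  using weighted_space.moment_atom[OF weighted, of i 0 0] weighted_space.moment_zero[OF weighted, of i 0]
  by auto

lemma frame_mem: "w \<in> \<D> \<Longrightarrow> j < n \<Longrightarrow> frame j w \<in> carrier S"
  using hilbert.zero_mem[OF summand] hilbert.scale_mem[OF summand]
  by (auto simp: mem_iff qh_frame_def atom_deriv_mem)

text \<open>
  The atoms of all the summands span a dense subspace.
\<close>

lemma eq_on_atoms:
  assumes A: "bounded_op S A" and B: "bounded_op S B"
    and eq: "\<And>j w. j < n \<Longrightarrow> w \<in> \<D> \<Longrightarrow> A (incl j (atom j w)) = B (incl j (atom j w))"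
    and x: "x \<in> carrier S"
  shows "A x = B x"
proof -
  let ?C = "\<lambda>x. A x - B x"
  have C: "bounded_op S ?C"
    by (rule total.bounded_op_diff[OF A B])
  have zero: "block ?C i j f = 0" if ij: "i < n" "j < n" and f: "f \<in> carrier (H j)" for i j f
    by (rule weighted_map.zero_on_atoms[OF weighted_map_block[OF C ij] _ f]) (simp add: block_eq eq ij)
  have "?C x = 0"
  proof (rule eqI)
    show "?C x \<in> carrier S"
      using C x by (simp add: bounded_op_def)
    show "?C x i = 0 i" if "i < n" for i
      using apply_blocks[OF C x, of i] that x by (simp add: zero component_mem)
  qed simp
  then show ?thesis
    by simp
qed

lemma T_frame_blocks:
  assumes w: "w \<in> \<D>" and j: "j < n"
  shows "(\<Sum>k<n. block T i k (frame j w k)) = w *\<^sub>C frame j w i"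
  using apply_blocks[OF T_bounded frame_mem[OF w j], of i] T_frame[OF w j] by simp

text \<open>
  The component of \<open>frame j w\<close> in the summand \<open>j\<close> is an atom, and its components beyond \<open>j\<close> vanish.
  Since the blocks in the columns before \<open>j\<close> are already known to vanish in row \<open>i\<close>, row \<open>i\<close> of
  \<open>T (frame j w) = w *\<^sub>C frame j w\<close> says that the block \<open>(i, j)\<close> annihilates the atoms.
\<close>

lemma T_lower_blocks_zero: "j < i \<Longrightarrow> i < n \<Longrightarrow> f \<in> carrier (H j) \<Longrightarrow> block T i j f = 0"
proof (induction j arbitrary: f rule: less_induct)
  case (less j)
  have j: "j < n"
    using less by simp
  show ?case
  proof (rule weighted_map.zero_on_atoms[OF weighted_map_block[OF T_bounded less.prems(2) j] _ less.prems(3)])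
    fix w assume w: "w \<in> \<D>"
    have "(\<Sum>k<n. block T i k (frame j w k)) = block T i j (frame j w j)"
    proof (rule sum_single)
      fix k assume k: "k \<in> {..<n}" "k \<noteq> j"
      show "block T i k (frame j w k) = 0"
      proof (cases "k < j")
        case True
        then show ?thesis
          using less k component_mem[OF frame_mem[OF w j]] by (intro less.IH) auto
      next
        case False
        then show ?thesis
          using k less.prems by (simp add: qh_frame_def block_zero[OF T_bounded])
      qed
    qed (use j in auto)
    then show "block T i j (atom j w) = 0"
      using T_frame_blocks[OF w j, of i] less.prems
      by (simp add: qh_frame_def \<mu>_diag[OF j] scaleC_one)
  qed
qed

lemma T_upper_triangular: "upper_triangular T"
  using T_lower_blocks_zero by (simp add: upper_triangular_def)

lemma T_frame_blocks_triangular: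
  assumes "w \<in> \<D>" "i < n" "j < n"
  shows "(\<Sum>k\<in>{i..j}. block T i k (frame j w k)) = w *\<^sub>C frame j w i"
proof -
  have "(\<Sum>k<n. block T i k (frame j w k)) = (\<Sum>k\<in>{i..j}. block T i k (frame j w k))"
    using assms component_mem[OF frame_mem]
    by (intro triangular_sum[OF T_bounded T_upper_triangular]) (auto simp: qh_frame_def)
  then show ?thesis
    using T_frame_blocks assms by simp
qed

lemma T_diag_atom:
  assumes j: "j < n" and w: "w \<in> \<D>"
  shows "block T j j (atom j w) = w *\<^sub>C atom j w"
  using T_frame_blocks_triangular[OF w j j] by (simp add: qh_frame_def \<mu>_diag[OF j] scaleC_one)

lemma T_diag_shift:
  assumes j: "j < n"
  shows "moment_shift (H j) (block T j j)"
  unfolding moment_shift_def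
proof (intro ballI conjI allI)
  interpret J: weighted_map "lam j" "H j" "lam j" "H j" "block T j j"
    by (rule weighted_map_block[OF T_bounded j j])
  fix f k assume f: "f \<in> carrier (H j)"
  then show "block T j j f \<in> carrier (H j)"
    by simp
  have "moment (H j) (block T j j f) k = 1 * moment (H j) f (Suc k)"
    by (rule J.moment_determined_by_atoms[OF _ f])
       (simp add: T_diag_atom[OF j] J.dom.moment_scale J.dom.atom_deriv_mem J.dom.moment_atom)
  then show "moment (H j) (block T j j f) k = moment (H j) f (Suc k)"
    by simp
qed

text \<open>
  Row \<open>i\<close> of the eigenvector equation for \<open>frame (i + 1) w\<close> involves two blocks only. The diagonal
  one fails to multiply the derivative of an atom by \<open>w\<close>, the defect being the atom itself, and the
  superdiagonal block has to compensate for it.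
\<close>

lemma T_superdiag_moment:
  assumes i: "Suc i < n" and f: "f \<in> carrier (H (Suc i))"
  shows "moment (H i) (block T i (Suc i) f) k = - \<mu> i (Suc i) * moment (H (Suc i)) f k"
proof -
  let ?j = "Suc i" and ?m = "\<mu> i (Suc i)"
  have i': "i < n"
    using i by simp
  interpret B: weighted_map "lam ?j" "H ?j" "lam i" "H i" "block T i ?j"
    by (rule weighted_map_block[OF T_bounded i' i])
  interpret D: bounded_map "H i" "H i" "block T i i"
    by (rule bounded_map_block[OF T_bounded i' i'])
  show ?thesis
  proof (rule B.moment_determined_by_atoms[OF _ f])
    fix w assume w: "w \<in> \<D>"
    let ?a = "atom_deriv (lam i) 1 w"
    have a: "?a \<in> carrier (H i)"
      by (rule atom_deriv_mem[OF i' w])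
    have "{i..?j} = {i, ?j}"
      by auto
    then have "block T i i (?m *\<^sub>C ?a) + block T i ?j (atom ?j w) = w *\<^sub>C (?m *\<^sub>C ?a)"
      using T_frame_blocks_triangular[OF w i' i] by (simp add: qh_frame_def \<mu>_diag[OF i] scaleC_one)
    then have "block T i ?j (atom ?j w) = (w * ?m) *\<^sub>C ?a - ?m *\<^sub>C block T i i ?a"
      using a by (simp add: D.scale scaleC_scaleC algebra_simps)
    then have "moment (H i) (block T i ?j (atom ?j w)) k
        = (w * ?m) * moment (H i) ?a k - ?m * moment (H i) ?a (Suc k)"
      using a T_diag_shift[OF i']
      by (simp add: B.cod.moment_diff B.cod.moment_scale moment_shift_def)
    also have "\<dots> = ?m * (w * moment (H i) ?a k - moment (H i) ?a (Suc k))"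
      by (simp add: algebra_simps)
    also have "w * moment (H i) ?a k = of_nat k * w ^ k"
      unfolding B.cod.moment_atom_deriv[OF w] moments_deriv_def by (cases k) auto
    also have "moment (H i) ?a (Suc k) = of_nat (Suc k) * w ^ k"
      unfolding B.cod.moment_atom_deriv[OF w] moments_deriv_def by simp
    finally show "moment (H i) (block T i ?j (atom ?j w)) k = - ?m * w ^ k"
      by (simp add: algebra_simps)
  qed
qed

lemma diagonal_block_adjoint:
  assumes "i < n" "f \<in> carrier (H i)"
  shows "block T i i f = adjoint_op (H i) mult_coordinate f"
  using weighted_space.adjoint_mult_coordinate[OF weighted T_diag_shift] assms by simp

section \<open>Similarity to the direct sum of the atoms\<close>

text \<open>
  With \<open>Q\<close> the operator made of these blocks, \<open>I - Q\<close> maps the atoms to the frame; hence the sign.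
\<close>

definition neg_frame_block :: "nat \<Rightarrow> nat \<Rightarrow> (complex \<Rightarrow> complex) \<Rightarrow> complex \<Rightarrow> complex"
  where "neg_frame_block i j f =
    (if i < j then (- \<mu> i j) *\<^sub>C from_moments (lam i) (moments_deriv (j - i) (moment (H j) f)) else 0)"

text \<open>
  The operator \<open>M\<close> that maps atoms to the frame intertwines \<open>T\<close> with the direct sum of its diagonal
  blocks, because both sides multiply by \<open>w\<close> on vectors with parameter \<open>w\<close>. A valency of at least \<open>2\<close>
  makes the blocks \<open>t\<^sub>j \<mapsto> D\<^sup>j\<^sup>-\<^sup>i t\<^sub>i\<close> of \<open>M\<close> bounded, and \<open>M\<close> is unipotent, hence invertible.
\<close>

lemma similar_to_atoms:
  assumes \<Lambda>: "\<Lambda> \<ge> 2"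
  shows "similar_ops S T (direct_sum_op n (\<lambda>i. block T i i))"
proof -
  let ?Q = "from_blocks neg_frame_block"
  let ?D = "direct_sum_op n (\<lambda>i. block T i i)"
  have Qb: "bounded_lin (H j) (H i) (neg_frame_block i j)" if ij: "i < n" "j < n" for i j
  proof (cases "i < j")
    case True
    have "2 * real (j - i) \<le> real (j - i) * \<Lambda>"
      using mult_left_mono[OF \<Lambda>, of "real (j - i)"] by simp
    then have "lam i + 2 * real (j - i) \<le> lam j"
      using lam_diff[of i "j - i"] True by simp
    then have "bounded_map (H j) (H i) (\<lambda>f. from_moments (lam i) (moments_deriv (j - i) (moment (H j) f)))"
      using ij True
      by (intro bounded_map_intro summand bounded_lin_moments_deriv[OF weighted[OF ij(2)] weighted[OF ij(1)]]) auto
    moreover have "neg_frame_block i j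
        = (\<lambda>f. (- \<mu> i j) *\<^sub>C from_moments (lam i) (moments_deriv (j - i) (moment (H j) f)))"
      using True by (simp add: neg_frame_block_def fun_eq_iff)
    ultimately show ?thesis
      by (simp only: bounded_map.bounded_lin_scaled)
  next
    case False
    then show ?thesis
      using ij bounded_lin_zero[OF summand summand] by (simp add: neg_frame_block_def[abs_def])
  qed
  have Q_zero: "neg_frame_block i j 0 = 0" if "i < n" "j < n" for i j
    by (rule bounded_map.zero[OF bounded_map_intro[OF summand[OF that(2)] summand[OF that(1)] Qb[OF that]]])
  have Q: "bounded_op S ?Q"
    by (rule bounded_op_from_blocks[OF Qb])
  interpret Q: bounded_map S S ?Q
    using Q total.bounded_map_iff by blast
  have nil: "(?Q ^^ k) x i = 0" if "x \<in> carrier S" "n - k \<le> i" for k x i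
    using that(2)
  proof (induction k arbitrary: i)
    case 0
    then show ?case
      using that(1) by (simp add: mem_iff)
  next
    case (Suc k)
    have Qk: "(?Q ^^ k) x \<in> carrier S"
      using total.bounded_op_funpow[OF Q] that(1) by (simp add: bounded_op_def)
    have "neg_frame_block i j ((?Q ^^ k) x j) = 0" if ij: "i < n" "j < n" for j
    proof (cases "i < j")
      case True
      then have "(?Q ^^ k) x j = 0"
        using Suc by (intro Suc.IH) auto
      then show ?thesis
        using ij by (simp add: Q_zero)
    qed (simp add: neg_frame_block_def)
    then have "(\<Sum>j<n. neg_frame_block i j ((?Q ^^ k) x j)) = 0" if "i < n"
      using that by (intro sum.neutral) auto
    moreover have "(?Q ^^ Suc k) x i = ?Q ((?Q ^^ k) x) i"
      by (simp only: funpow.simps comp_apply)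
    ultimately show ?case
      using from_blocks_apply[of neg_frame_block "(?Q ^^ k) x" i] by presburger
  qed
  have "(?Q ^^ n) x = 0" if "x \<in> carrier S" for x
    using nil[OF that, of n] by (simp add: fun_eq_iff)
  then obtain L where L: "bounded_op S L" "\<And>x. x \<in> carrier S \<Longrightarrow> L (x - ?Q x) = x"
    "\<And>x. x \<in> carrier S \<Longrightarrow> L x - ?Q (L x) = x"
    using total.neumann_inverse[OF Q] by metis
  define M where "M x = x - ?Q x" for x
  have M: "bounded_op S M"
    unfolding M_def by (rule total.bounded_op_diff[OF total.bounded_op_id Q])
  interpret M: bounded_map S S M
    using M total.bounded_map_iff by blast
  have M_atom: "M (incl j (atom j w)) = frame j w" if j: "j < n" and w: "w \<in> \<D>" for j w
  proof
    fix i
    interpret J: weighted_space "lam j" "H j"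
      by (rule weighted[OF j])
    have "?Q (incl j (atom j w)) i = (if i < n then neg_frame_block i j (atom j w) else 0)"
    proof -
      have "(\<Sum>k<n. neg_frame_block i k (incl j (atom j w) k)) = neg_frame_block i j (incl j (atom j w) j)"
        if "i < n"
        using j that by (intro sum_single) (auto simp: Q_zero)
      then show ?thesis
        by (simp add: from_blocks_apply)
    qed
    moreover have "from_moments (lam i) (moments_deriv (j - i) (moment (H j) (atom j w)))
        = atom_deriv (lam i) (j - i) w"
    proof -
      have "moment (H j) (atom j w) = (\<lambda>k. w ^ k)"
        using J.moment_atom[OF w] by blast
      then show ?thesis
        by (simp add: atom_deriv_eq_from_moments[OF w lam_pos])
    qed
    ultimately show "M (incl j (atom j w)) i = frame j w i"
      using j by (auto simp: M_def neg_frame_block_def qh_frame_def \<mu>_diag scaleC_one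
          complex_vs.scale_minus_left incl_def)
  qed
  have D: "bounded_op S ?D"
    by (rule bounded_op_direct_sum_op[OF bounded_lin_block[OF T_bounded]])
  have TM: "T (M x) = M (?D x)" if x: "x \<in> carrier S" for x
  proof (rule eq_on_atoms[OF total.bounded_op_compose[OF T_bounded M] total.bounded_op_compose[OF M D] _ x])
    fix j w assume jw: "j < n" "w \<in> \<D>"
    have "?D (incl j (atom j w)) = w *\<^sub>C incl j (atom j w)"
      using jw by (simp add: direct_sum_op_incl block_zero[OF T_bounded] T_diag_atom incl_scale)
    then show "T (M (incl j (atom j w))) = M (?D (incl j (atom j w)))"
      using jw by (simp add: M.scale incl_mem atom_deriv_mem M_atom T_frame)
  qed
  have Dx: "?D x \<in> carrier S" if "x \<in> carrier S" for x
    using D that by (simp add: bounded_op_def)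
  show ?thesis
    unfolding similar_ops_def
  proof (rule exI[of _ L], rule exI[of _ M], intro conjI ballI)
    fix x assume x: "x \<in> carrier S"
    show "L (M x) = x" "M (L x) = x"
      using L x by (simp_all add: M_def)
    show "L (T (M x)) = ?D x"
      unfolding TM[OF x] using L(2)[OF Dx[OF x]] by (simp add: M_def)
  qed (rule L M)+
qed

lemma strongly_reducible_of_valency_ge_2:
  assumes "\<Lambda> \<ge> 2"
  shows "strongly_reducible S T"
proof (rule total.strongly_reducible_similar[OF similar_to_atoms[OF assms] T_bounded])
  have "\<exists>x\<in>carrier (H i). x \<noteq> 0" if "i < n" for i
    using atom_deriv_mem[OF that, of 0 0] atom_nonzero[OF that] by auto
  then show "strongly_reducible S (direct_sum_op n (\<lambda>i. block T i i))"
    by (intro strongly_reducible_direct_sum_op bounded_lin_block T_bounded n_ge)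
qed

section \<open>Idempotents in the commutant\<close>

context
  fixes P
  assumes P: "bounded_op S P"
    and comm: "\<And>x. x \<in> carrier S \<Longrightarrow> P (T x) = T (P x)"
begin

lemma commuting_blocks:
  assumes "j < n" "f \<in> carrier (H j)"
  shows "(\<Sum>k<n. block P i k (block T k j f)) = (\<Sum>k<n. block T i k (block P k j f))"
  using block_compose[OF P T_bounded assms, of i] block_compose[OF T_bounded P assms, of i]
    comm[OF incl_mem[OF assms]] by simp

text \<open>
  The block in the bottom left corner intertwines two diagonal blocks of \<open>T\<close>, and it maps into the
  space of larger weight, so it is zero. Once all blocks on the lower subdiagonals beyond the one
  through \<open>(i, j)\<close> are gone, the same holds for the block \<open>(i, j)\<close>.
\<close>

lemma commutant_lower_blocks_zero: "j < i \<Longrightarrow> i < n \<Longrightarrow> f \<in> carrier (H j) \<Longrightarrow> block P i j f = 0"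
proof (induction "n - (i - j)" arbitrary: i j f rule: less_induct)
  case less
  have j: "j < n"
    using less.prems by simp
  interpret X: weighted_map "lam j" "H j" "lam i" "H i" "block P i j"
    by (rule weighted_map_block[OF P less.prems(2) j])
  have IH: "block P k m g = 0" if "i - j < k - m" "k < n" "g \<in> carrier (H m)" for k m g
    using that less.prems by (intro less.hyps) auto
  have eq: "block P i j (block T j j g) = block T i i (block P i j g)" if g: "g \<in> carrier (H j)" for g
  proof -
    have "(\<Sum>k<n. block P i k (block T k j g)) = block P i j (block T j j g)"
    proof (rule sum_single)
      fix k assume k: "k \<in> {..<n}" "k \<noteq> j"
      show "block P i k (block T k j g) = 0"
      proof (cases "k < j")
        case True
        then show ?thesis
          using k j g less.prems by (intro IH block_mem[OF T_bounded]) auto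
      next
        case False
        then have "block T k j g = 0"
          using k g by (intro T_lower_blocks_zero) auto
        then show ?thesis
          using k less.prems by (simp add: block_zero[OF P])
      qed
    qed (use j in auto)
    moreover have "(\<Sum>k<n. block T i k (block P k j g)) = block T i i (block P i j g)"
    proof (rule sum_single)
      fix k assume k: "k \<in> {..<n}" "k \<noteq> i"
      show "block T i k (block P k j g) = 0"
      proof (cases "k < i")
        case True
        then show ?thesis
          using k j g less.prems by (intro T_lower_blocks_zero block_mem[OF P]) auto
      next
        case False
        then have "block P k j g = 0"
          using k g less.prems by (intro IH) auto
        then show ?thesis
          using k less.prems by (simp add: block_zero[OF T_bounded])
      qed
    qed (use less.prems in auto)
    ultimately show ?thesis
      using commuting_blocks[OF j g, of i] by simp
  qed
  show ?case
  proof (rule X.intertwiner_zero[OF T_diag_shift[OF j] _ _ less.prems(3)])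
    show "moment (H i) (block P i j g) (Suc k) = moment (H i) (block P i j (block T j j g)) k"
      if "g \<in> carrier (H j)" for g k
      using T_diag_shift[OF less.prems(2)] that by (simp add: eq moment_shift_def)
    show "lam j < lam i"
      using less.prems(1) valency_pos by (simp add: qh_weight_def)
  qed
qed

lemma commutant_upper_triangular: "upper_triangular P"
  using commutant_lower_blocks_zero by (simp add: upper_triangular_def)

lemma commuting_blocks_triangular:
  assumes "i < n" "j < n" "f \<in> carrier (H j)"
  shows "(\<Sum>k\<in>{i..j}. block P i k (block T k j f)) = (\<Sum>k\<in>{i..j}. block T i k (block P k j f))"
  using block_compose_triangular[OF P commutant_upper_triangular T_bounded T_upper_triangular assms]
    block_compose_triangular[OF T_bounded T_upper_triangular P commutant_upper_triangular assms]
    comm[OF incl_mem[OF assms(2,3)]] by simp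

text \<open>
  If adjacent diagonal blocks of \<open>P\<close> are different scalars, entry \<open>(i, i + 1)\<close> of \<open>P T = T P\<close> becomes
  the relation of \<open>inner_derivation_bound\<close> with \<open>c = (b - a) \<mu> i (i + 1)\<close>.
\<close>

lemma adjacent_diagonal_blocks_equal:
  assumes \<Lambda>: "\<Lambda> < 2" and i: "Suc i < n"
    and Pi: "\<And>f. f \<in> carrier (H i) \<Longrightarrow> block P i i f = a *\<^sub>C f"
    and Pj: "\<And>f. f \<in> carrier (H (Suc i)) \<Longrightarrow> block P (Suc i) (Suc i) f = b *\<^sub>C f"
  shows "a = b"
proof (rule ccontr)
  assume a: "a \<noteq> b"
  let ?j = "Suc i" and ?m = "\<mu> i (Suc i)"
  have i': "i < n"
    using i by simp
  interpret X: weighted_map "lam ?j" "H ?j" "lam i" "H i" "block P i ?j"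
    by (rule weighted_map_block[OF P i' i])
  interpret R: bounded_map "H ?j" "H i" "block T i ?j"
    by (rule bounded_map_block[OF T_bounded i' i])
  have rel: "moment (H i) (block P i ?j f) (Suc k)
      = moment (H i) (block P i ?j (block T ?j ?j f)) k + (b - a) * ?m * moment (H ?j) f k"
    if f: "f \<in> carrier (H ?j)" for f k
  proof -
    have "{i..?j} = {i, ?j}"
      by auto
    then have "a *\<^sub>C block T i ?j f + block P i ?j (block T ?j ?j f)
        = block T i i (block P i ?j f) + b *\<^sub>C block T i ?j f"
      using commuting_blocks_triangular[OF i' i f] f by (simp add: Pi Pj R.scale)
    then have "moment (H i) (a *\<^sub>C block T i ?j f + block P i ?j (block T ?j ?j f)) k
        = moment (H i) (block T i i (block P i ?j f) + b *\<^sub>C block T i ?j f) k"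
      by simp
    then have "a * moment (H i) (block T i ?j f) k + moment (H i) (block P i ?j (block T ?j ?j f)) k
        = moment (H i) (block P i ?j f) (Suc k) + b * moment (H i) (block T i ?j f) k"
      using f T_diag_shift[OF i'] T_diag_shift[OF i]
      by (simp add: X.cod.moment_add X.cod.moment_scale moment_shift_def)
    then show ?thesis
      by (simp add: T_superdiag_moment[OF i f] algebra_simps)
  qed
  have "lam i + 2 \<le> lam ?j"
    using X.inner_derivation_bound[OF T_diag_shift[OF i] rel] a \<mu>_superdiag[OF i] by simp
  then show False
    using \<Lambda> lam_diff[of i 1] by simp
qed

text \<open>
  All diagonal blocks of \<open>P\<close> are \<open>0\<close>, or all are the identity. By triangularity, \<open>P\<close> then has no
  non-zero fixed vectors in the first case and no non-zero kernel in the second.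
\<close>

lemma commuting_idempotent_trivial:
  assumes \<Lambda>: "\<Lambda> < 2" and idem: "\<And>x. x \<in> carrier S \<Longrightarrow> P (P x) = P x"
  shows "(\<forall>x\<in>carrier S. P x = 0) \<or> (\<forall>x\<in>carrier S. P x = x)"
proof -
  interpret P: bounded_map S S P
    using P total.bounded_map_iff by blast
  have diag: "(\<forall>f\<in>carrier (H i). block P i i f = 0) \<or> (\<forall>f\<in>carrier (H i). block P i i f = f)"
    if i: "i < n" for i
  proof (rule weighted_space.commuting_idempotent[OF weighted[OF i] bounded_lin_block[OF P i i] T_diag_shift[OF i]])
    fix f assume f: "f \<in> carrier (H i)"
    show "block P i i (block T i i f) = block T i i (block P i i f)"
      using commuting_blocks_triangular[OF i i f] by simp
    show "block P i i (block P i i f) = block P i i f"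
      using block_compose_triangular[OF P commutant_upper_triangular P commutant_upper_triangular i i f]
        idem[OF incl_mem[OF i f]] by (simp add: block_eq)
  qed
  define scalar where "scalar i c \<longleftrightarrow> (\<forall>f\<in>carrier (H i). block P i i f = c *\<^sub>C f)" for i c
  have diag: "scalar i 0 \<or> scalar i 1" if "i < n" for i
    using diag[OF that] by (simp add: scalar_def scaleC_one)
  have step: "scalar (Suc i) c" if "scalar i c" "Suc i < n" "c = 0 \<or> c = 1" for i c
    using diag[OF that(2)] adjacent_diagonal_blocks_equal[OF \<Lambda> that(2), of c] that
    unfolding scalar_def by (metis zero_neq_one)
  have all: "scalar i c" if "scalar 0 c" "i < n" "c = 0 \<or> c = 1" for i c
    using that(2)
  proof (induction i)
    case (Suc i)
    then show ?case
      using step that(3) by simp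
  qed (use that in simp)
  have comp: "P y i = block P i i (y i)"
    if y: "y \<in> carrier S" "i < n" "\<And>j. i < j \<Longrightarrow> j < n \<Longrightarrow> y j = 0" for y i
    using apply_blocks[OF P y(1), of i] triangular_sum[OF P commutant_upper_triangular y(2) y(2), of y]
      component_mem[OF y(1)] y by simp
  have eq_zero: "y = 0" if y: "y \<in> carrier S" and z: "\<And>i. i < n \<Longrightarrow> (\<And>j. i < j \<Longrightarrow> j < n \<Longrightarrow> y j = 0) \<Longrightarrow> y i = 0" for y
  proof (rule eqI)
    have "y i = 0" if "i < n" for i
      by (rule downward_zero[OF z that])
    then show "y i = 0 i" if "i < n" for i
      using that by simp
  qed (simp_all add: y)
  from diag[of 0] n_ge consider "scalar 0 0" | "scalar 0 1"
    by auto
  then show ?thesis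
  proof cases
    case 1
    have "P x = 0" if x: "x \<in> carrier S" for x
    proof (rule eq_zero)
      fix i assume i: "i < n" "\<And>j. i < j \<Longrightarrow> j < n \<Longrightarrow> P x j = 0"
      have "P (P x) i = block P i i (P x i)"
        using x i by (intro comp) auto
      then show "P x i = 0"
        using all[OF 1 i(1)] component_mem[OF P.mem[OF x] i(1)] by (simp add: idem[OF x] scalar_def)
    qed (use x in simp)
    then show ?thesis
      by blast
  next
    case 2
    have "x - P x = 0" if x: "x \<in> carrier S" for x
    proof (rule eq_zero)
      have m: "x - P x \<in> carrier S"
        using x by simp
      fix i assume i: "i < n" "\<And>j. i < j \<Longrightarrow> j < n \<Longrightarrow> (x - P x) j = 0"
      have "P (x - P x) i = block P i i ((x - P x) i)"
        by (rule comp[OF m i])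
      moreover have "P (x - P x) = 0"
        using x by (simp add: P.diff idem)
      ultimately show "(x - P x) i = 0"
        using all[OF 2 i(1)] component_mem[OF m i(1)] by (simp only: scalar_def scaleC_one) simp
    qed (use x in simp)
    then show ?thesis
      by simp
  qed
qed

end

lemma strongly_irreducible_of_valency_less_2:
  assumes "\<Lambda> < 2"
  shows "strongly_irreducible S T"
  unfolding strongly_irreducible_def using commuting_idempotent_trivial[OF _ _ assms] by blast

end

theorem lemma3p4:
  fixes n :: nat
    and lam0 \<Lambda> :: real
    and \<mu> :: "nat \<Rightarrow> nat \<Rightarrow> complex"
    and H :: "nat \<Rightarrow> (complex \<Rightarrow> complex) hspace"
    and T :: "(nat \<Rightarrow> complex \<Rightarrow> complex) \<Rightarrow> nat \<Rightarrow> complex \<Rightarrow> complex"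
  assumes "quasi_homogeneous_curve n lam0 \<Lambda> \<mu>"
    and "\<forall>i<n. is_A_space (qh_weight lam0 \<Lambda> i) (H i)"
    and "quasi_homogeneous_op n lam0 \<Lambda> \<mu> H T"
  shows "(\<forall>i<n. \<forall>f\<in>carrier (H i). block T i i f = adjoint_op (H i) mult_coordinate f) \<and>
    (\<Lambda> \<ge> 2 \<longrightarrow>
      strongly_reducible (direct_sum n H) T \<and>
      similar_ops (direct_sum n H) T (direct_sum_op n (\<lambda>i. block T i i))) \<and>
    (\<Lambda> < 2 \<longrightarrow> strongly_irreducible (direct_sum n H) T)"
proof -
  interpret quasi_homogeneous n lam0 \<Lambda> \<mu> H T
    using assms by unfold_locales
  show ?thesis
    using diagonal_block_adjoint strongly_reducible_of_valency_ge_2 similar_to_atoms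
      strongly_irreducible_of_valency_less_2 by blast
qed

end
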